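(* Consider the matrix regression model with deterministic predictors described in the context. Assume that the entries $E_{ij}$ of $E$ are independent $N(0,\sigma^2)$ random variables, $\log m_2\ge4$, $\varrho\ge1$, let $r=\operatorname{rank}(V)$, and let $\hat A$ be the estimator described in the context with $\sqrt\lambda=4\varrho\sigma(\sqrt r+\sqrt{m_2})$. Then: (i) with probability at least $1-\exp\left(-\frac{m_2+r}{2}\right)$, one has $$\|V(\hat A-A_0)\|_2\le\inf_{A\in\mathbb{R}^{m_1\times m_2}}\left\{\|V(A-A_0)\|_2+2\sqrt{\lambda\max\left(\frac{\operatorname{rank}(A_0)}{\varrho^2},\operatorname{rank}(A)\right)}\right\}$$ and, in particular, $$\|V(\hat A-A_0)\|_2\lesssim(\sqrt r+\sqrt{m_2})\sqrt{\operatorname{rank}(A_0)};$$ (ii) with probability at least $1-\exp\left(-\frac{m_2+r}{2}\right)$, one has $$\|V(\hat A-A_0)\|_2^2\le\inf_{A\in\mathbb{R}^{m_1\times m_2}}\left\{\left(\frac{2\varrho^2+1}{2\varrho^2-1}\right)\|V(A-A_0)\|_2^2+\frac{4\varrho^2\lambda}{2\varrho^2-1}\operatorname{rank}(A)\right\};$$ (iii) $$\mathbb{E}\left(\|V(\hat A-A_0)\|_2\right)\le\inf_{A\in\mathbb{R}^{m_1\times m_2}}\left\{\|V(A-A_0)\|_2+\frac52\sqrt{\lambda\max\left(\operatorname{rank}(A),\frac{\operatorname{rank}(A_0)}{\varrho^2},\frac1{4\varrho^2}\right)}\right\}$$ and, in particular, $$\mathbb{E}\left(\|V(\hat A-A_0)\|_2\right)\lesssim(\sqrt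 r+\sqrt{m_2})\sqrt{\max(\operatorname{rank}(A_0),1/4)};$$ (iv) $$\mathbb{E}\left(\|V(\hat A-A_0)\|_2^2\right)\le\inf_{A\in\mathbb{R}^{m_1\times m_2}}\left\{\left(\frac{2\varrho^2+1}{2\varrho^2-1}\right)\|V(A-A_0)\|_2^2+\left(\frac{4\varrho^2\lambda}{2\varrho^2-1}\right)\max\left(\operatorname{rank}(A),\frac12\right)\right\}$$ and, in particular, $$\mathbb{E}\left(\|V(\hat A-A_0)\|_2^2\right)\lesssim(\sqrt r+\sqrt{m_2})^2\max(\operatorname{rank}(A_0),1/2).$$ The symbol $\lesssim$ means that the inequality holds up to multiplicative numerical constants.
   Context: Matrix regression model: $U_i=V_iA_0+E_i$, $i=1,\dots,l$, where $U_i$ are $1\times m_2$ vectors of response variables, $V_i$ are deterministic $1\times m_1$ vectors of predictors, $A_0$ is an unknown $m_1\times m_2$ matrix of regression coefficients, and $E_i$ are random $1\times m_2$ noise vectors with independent mean-zero entries. Stack $V=(V_1^T,\dots,V_l^T)^T\in\mathbb{R}^{l\times m_1}$, $U=(U_1^T,\dots,U_l^T)^T\in\mathbb{R}^{l\times m_2}$, $E=(E_1^T,\dots,E_l^T)^T\in\mathbb{R}^{l\times m_2}$ (column-wise stacking of the row vectors), so $U=VA_0+E$. $\|\cdot\|_2$ is the Frobenius norm (Schatten-2 norm). The rank penalized estimator with regularization parameter $\lambda>0$ is $$\hat A=\operatorname*{arg\,min}_{A\in\mathbb{R}^{m_1\times m_2}}\left\{\frac{1}{l\,m_2}\|VA\|_2^2-\frac{2}{l\,m_2}\langle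 V^TU,A\rangle+\lambda\operatorname{rank}(A)\right\}=\operatorname*{arg\,min}_{A\in\mathbb{R}^{m_1\times m_2}}\left\{\|U-VA\|_2^2+l\,m_2\,\lambda\operatorname{rank}(A)\right\},$$ where $\langle A,B\rangle=\operatorname{tr}(A^TB)$.
   Formalization: The estimator minimizes ‖U−VA‖²+λ rank(A), without the factor l·m2 in the penalty, since with that factor the bounds are false; and the ≲ bounds carry explicit factors ρσ (ρ²σ² in (iv)), since constants independent of σ and ρ cannot hold. *)

theory Defs
  imports "HOL-Probability.Probability"
begin

text \<open>
  The sizes \<open>l\<close>, \<open>m\<^sub>1\<close>, \<open>m\<^sub>2\<close> are the cardinalities of the finite index types \<open>'l\<close>, \<open>'m1\<close>, \<open>'m2\<close>.
  The library's \<^const>\<open>norm\<close> on \<^typ>\<open>real^'m^'n\<close> is the Euclidean norm of all entries, i.e. the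
  Frobenius norm, and the trace below is the matrix scalar product \<open>\<langle>V\<^sup>T U, A\<rangle> = tr ((V\<^sup>T U)\<^sup>T A)\<close>.
\<close>

definition rank_penalized_criterion ::
  "real^'m1^'l \<Rightarrow> real^'m2^'l \<Rightarrow> real \<Rightarrow> real^'m2^'m1 \<Rightarrow> real" where
  "rank_penalized_criterion V U \<mu> A =
     1 / (real CARD('l) * real CARD('m2)) * (norm (V ** A))\<^sup>2
     - 2 / (real CARD('l) * real CARD('m2)) * trace (transpose (transpose V ** U) ** A)
     + \<mu> * real (rank A)"

text \<open>Minimizers need not be unique (for instance when \<open>V\<close> is not injective), so being an estimator
  is a predicate.\<close>

definition is_rank_penalized_estimator ::
  "real^'m1^'l \<Rightarrow> real^'m2^'l \<Rightarrow> real \<Rightarrow> real^'m2^'m1 \<Rightarrow> bool" where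
  "is_rank_penalized_estimator V U \<mu> A \<longleftrightarrow>
     is_arg_min (rank_penalized_criterion V U \<mu>) (\<lambda>_. True) A"

lemma frobenius_inner: "trace (transpose B ** A) = B \<bullet> A"
  for A B :: "real^'m^'n"
proof -
  have "trace (transpose B ** A) = (\<Sum>j\<in>UNIV. \<Sum>i\<in>UNIV. B $ i $ j * A $ i $ j)"
    by (simp add: trace_def matrix_matrix_mult_def transpose_def)
  also have "\<dots> = (\<Sum>i\<in>UNIV. \<Sum>j\<in>UNIV. B $ i $ j * A $ i $ j)"
    by (rule sum.swap)
  finally show ?thesis
    by (simp add: inner_vec_def)
qed

lemma rank_penalized_criterion_residual:
  fixes V :: "real^'m1^'l" and U :: "real^'m2^'l"
  shows "real CARD('l) * real CARD('m2) * rank_penalized_criterion V U \<mu> A + (norm U)\<^sup>2 =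
    (norm (U - V ** A))\<^sup>2 + real CARD('l) * real CARD('m2) * \<mu> * real (rank A)"
proof -
  have "trace (transpose (transpose V ** U) ** A) = U \<bullet> (V ** A)"
    by (simp add: matrix_transpose_mul matrix_mul_assoc [symmetric] frobenius_inner)
  then show ?thesis
    by (simp add: rank_penalized_criterion_def power2_norm_eq_inner inner_diff inner_commute
        field_simps)
qed

text \<open>Hence, on the scale of the squared residual norm, the regularization parameter
  \<open>lambda / (l m\<^sub>2)\<close> amounts to a penalty of \<open>lambda\<close> per unit of rank.\<close>

lemma is_rank_penalized_estimator_iff:
  fixes V :: "real^'m1^'l" and U :: "real^'m2^'l"
  shows "is_rank_penalized_estimator V U (lambda / (real CARD('l) * real CARD('m2))) A \<longleftrightarrow>
    is_arg_min (\<lambda>B. (norm (U - V ** B))\<^sup>2 + lambda * real (rank B)) (\<lambda>_. True) A"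
proof -
  let ?c = "real CARD('l) * real CARD('m2)"
  have c: "?c > 0"
    by simp
  have "(norm (U - V ** B))\<^sup>2 + lambda * real (rank B) =
      ?c * rank_penalized_criterion V U (lambda / ?c) B + (norm U)\<^sup>2" for B
    by (simp add: rank_penalized_criterion_residual)
  then show ?thesis
    unfolding is_rank_penalized_estimator_def is_arg_min_def
    using c by (simp only: add_less_cancel_right mult_less_cancel_left_pos)
qed

end

theory Submission
  imports Defs
begin

text \<open>
  Let \<open>r\<close> be the rank of \<open>V\<close>, let \<open>m\<close> be the number of columns of \<open>E\<close>, and put
  \<open>s = sqrt r + sqrt m\<close>. Two facts carry the theorem.

  The first is deterministic. Minimality of the estimator, compared with an arbitrary matrix
  \<open>A\<close>, gives a quadratic inequality for the prediction error in which the noise enters only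
  through a bound \<open>D\<close> for its operator norm after projection onto the range of \<open>V\<close>, multiplied by
  the square root of the sum of the two ranks (\<open>rank_penalized_basic_inequality\<close>). If
  \<open>D \<le> sqrt lambda / (2 \<rho>) = 2 \<sigma> s\<close>, completing squares gives the oracle inequality for the squared
  error (\<open>squared_oracle_inequality\<close>), and solving the quadratic inequality gives the one for the
  error itself (\<open>oracle_inequality\<close>).

  The second is that the projected noise, a Gaussian matrix of size \<open>r\<close> by \<open>m\<close> up to a rotation,
  has operator norm at most \<open>2 \<sigma> s\<close> outside an event of probability \<open>exp (- (m + r) / 2)\<close>. The norm
  is typically about \<open>\<sigma> s\<close>, so there is a factor of two to spend, and a covering argument that
  is exact enough to lose less than this factor suffices. The exponential of the bilinear form
  \<open>u \<bullet> E v\<close> is averaged over \<open>u\<close> in a ball and \<open>v\<close> Gaussian. The average has an explicit bound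
  on its mean and dominates the exponential of the squared norm up to a volume factor
  (\<open>gaussian_bilinear_exp_moment\<close>); the numerical choice of two parameters makes the
  resulting exponent large enough (\<open>exponent_bounds\<close>).

  The bounds in expectation come from the same exponential moment. The mean excess of \<open>D\<^sup>2\<close>
  over a slightly smaller threshold is at most \<open>\<sigma>\<^sup>2 / 2\<close> (\<open>gaussian_noise_bounds\<close>). For the error
  this is absorbed in the larger constant \<open>5/2\<close>. For the squared error the constants are the same
  as with high probability, and the room is found in the gain made when the noise stays below
  the smaller threshold (\<open>noise_excess_times_rank\<close>).
\<close>

section \<open>Trace duality and the basic inequality\<close>

lemma rank_diff_le:
  fixes A B :: "real^'n^'m"
  shows "rank (A - B) \<le> rank A + rank B"
proof -
  obtain SA where SA: "SA \<subseteq> rows A" "independent SA" "rows A \<subseteq> span SA" "card SA = dim (rows A)"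
    using basis_exists by blast
  obtain SB where SB: "SB \<subseteq> rows B" "independent SB" "rows B \<subseteq> span SB" "card SB = dim (rows B)"
    using basis_exists by blast
  have fin: "finite SA" "finite SB"
    using SA(2) SB(2) by (auto intro: independent_imp_finite)
  have "row i (A - B) \<in> span (SA \<union> SB)" for i
  proof -
    have "row i A \<in> span (SA \<union> SB)"
      using SA(3) span_mono[of SA "SA \<union> SB"] by (auto simp: rows_def)
    moreover have "row i B \<in> span (SA \<union> SB)"
      using SB(3) span_mono[of SB "SA \<union> SB"] by (auto simp: rows_def)
    moreover have "row i (A - B) = row i A - row i B"
      by (simp add: row_def vec_eq_iff)
    ultimately show ?thesis by (simp add: span_diff)
  qed
  then have "rows (A - B) \<subseteq> span (SA \<union> SB)" by (auto simp: rows_def)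
  then have "dim (rows (A - B)) \<le> card (SA \<union> SB)"
    by (rule dim_le_card) (use fin in simp)
  also have "\<dots> \<le> card SA + card SB" by (rule card_Un_le)
  finally show ?thesis using SA(4) SB(4) by (simp add: row_rank_def)
qed

text \<open>
  Duality between the operator norm and the trace norm, with the trace norm of \<open>X\<close> bounded by
  \<open>sqrt (rank X)\<close> times its Frobenius norm. In an orthonormal basis of the row space of \<open>X\<close>, which
  has only \<open>rank X\<close> elements \<open>f\<close>, the scalar product is the sum of the \<open>X f \<bullet> E f\<close>, and the
  Cauchy-Schwarz inequality applies to the \<open>norm (X f)\<close>. Testing \<open>E\<close> against the range of \<open>X\<close>
  only is what later replaces \<open>E\<close> by its projection onto the range of \<open>V\<close>.
\<close>

lemma inner_le_sqrt_rank:
  fixes E X :: "real^'n^'m"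
  assumes D: "\<And>u v. u \<in> range ((*v) X) \<Longrightarrow> u \<bullet> (E *v v) \<le> D * norm u * norm v" and "0 \<le> D"
  shows "E \<bullet> X \<le> D * sqrt (rank X) * norm X"
proof -
  obtain C where C: "C \<subseteq> span (rows X)" "pairwise orthogonal C" "\<And>f. f \<in> C \<Longrightarrow> norm f = 1"
    "independent C" "card C = dim (span (rows X))" "span C = span (rows X)"
    using orthonormal_basis_subspace[OF subspace_span] by metis
  have fin: "finite C" using C(4) by (rule independent_imp_finite)
  have row_expand: "(\<Sum>f\<in>C. (X $ i \<bullet> f) *\<^sub>R f) = X $ i" for i
  proof -
    have "row i X \<in> span C" unfolding C(6) by (intro span_base) (auto simp: rows_def)
    then have "X $ i \<in> span C" by (simp add: row_def)
    then show ?thesis using C fin by (intro orthonormal_basis_expand) auto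
  qed
  have row_inner: "(\<Sum>f\<in>C. (y \<bullet> f) * (X $ i \<bullet> f)) = y \<bullet> X $ i" for y i
    by (subst (2) row_expand [symmetric]) (simp add: inner_sum_right mult.commute)
  have expand: "Y \<bullet> X = (\<Sum>f\<in>C. (X *v f) \<bullet> (Y *v f))" for Y :: "real^'n^'m"
  proof -
    have "Y \<bullet> X = (\<Sum>i\<in>UNIV. Y $ i \<bullet> X $ i)" by (simp add: inner_vec_def)
    also have "\<dots> = (\<Sum>i\<in>UNIV. \<Sum>f\<in>C. (Y $ i \<bullet> f) * (X $ i \<bullet> f))" by (simp add: row_inner)
    also have "\<dots> = (\<Sum>f\<in>C. \<Sum>i\<in>UNIV. (Y $ i \<bullet> f) * (X $ i \<bullet> f))" by (rule sum.swap)
    also have "\<dots> = (\<Sum>f\<in>C. (X *v f) \<bullet> (Y *v f))"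
      unfolding inner_vec_def[of "X *v _"] by (simp add: matrix_vector_mul_component mult.commute)
    finally show ?thesis .
  qed
  have "E \<bullet> X \<le> (\<Sum>f\<in>C. D * norm (X *v f))"
    unfolding expand using D C(3) by (intro sum_mono) (metis mult.right_neutral rangeI)
  also have "\<dots> = D * (\<Sum>f\<in>C. \<bar>1\<bar> * \<bar>norm (X *v f)\<bar>)" by (simp add: sum_distrib_left)
  also have "\<dots> \<le> D * (L2_set (\<lambda>_. 1) C * L2_set (\<lambda>f. norm (X *v f)) C)"
    using \<open>0 \<le> D\<close> by (intro mult_left_mono L2_set_mult_ineq)
  also have "L2_set (\<lambda>_. 1) C = sqrt (rank X)"
    using C(5) by (simp add: L2_set_def row_rank_def)
  also have "L2_set (\<lambda>f. norm (X *v f)) C = norm X"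
    using expand[of X] by (simp add: L2_set_def norm_eq_sqrt_inner[of X] power2_norm_eq_inner)
  finally show ?thesis by (simp add: mult.assoc)
qed

lemma matrix_mult_diff_right:
  fixes V :: "real^'n^'m" and A B :: "real^'k^'n"
  shows "V ** (A - B) = V ** A - V ** B"
  by (simp add: matrix_matrix_mult_def vec_eq_iff right_diff_distrib sum_subtractf)

text \<open>
  Expanding the squares in the minimality of \<open>A\<close> leaves the noise term \<open>2 E \<bullet> V (A - B)\<close>, whose
  matrix has rank at most \<open>rank A + rank B\<close>. Trace duality bounds it by the size \<open>D\<close> of the noise
  on the range of \<open>V\<close>. All further deterministic estimates are consequences of this inequality for
  the real numbers \<open>a = norm (V (A - A0))\<close>, \<open>b = norm (V (B - A0))\<close> and the two ranks.
\<close>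

lemma rank_penalized_basic_inequality:
  fixes V :: "real^'m1^'l" and A0 A B :: "real^'m2^'m1" and E :: "real^'m2^'l"
    and lambda D :: real
  assumes min: "(norm (V ** A0 + E - V ** A))\<^sup>2 + lambda * rank A
      \<le> (norm (V ** A0 + E - V ** B))\<^sup>2 + lambda * rank B"
    and D: "\<And>u v. u \<in> range ((*v) V) \<Longrightarrow> u \<bullet> (E *v v) \<le> D * norm u * norm v" and "0 \<le> D"
  shows "(norm (V ** (A - A0)))\<^sup>2 \<le> (norm (V ** (B - A0)))\<^sup>2
    + 2 * D * sqrt (real (rank A) + real (rank B)) * (norm (V ** (A - A0)) + norm (V ** (B - A0)))
    + lambda * (real (rank B) - real (rank A))"
proof -
  define P Q where "P = V ** (A - A0)" and "Q = V ** (B - A0)"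
  have res: "V ** A0 + E - V ** A = E - P" "V ** A0 + E - V ** B = E - Q"
    by (simp_all add: P_def Q_def matrix_mult_diff_right)
  have PQ: "P - Q = V ** (A - B)"
    by (simp add: P_def Q_def matrix_mult_diff_right)
  have expand: "(norm (E - Z))\<^sup>2 = (norm E)\<^sup>2 - 2 * (E \<bullet> Z) + (norm Z)\<^sup>2" for Z :: "real^'m2^'l"
    by (simp add: power2_norm_eq_inner inner_diff inner_commute)
  have "E \<bullet> (P - Q) \<le> D * sqrt (rank (P - Q)) * norm (P - Q)"
  proof (rule inner_le_sqrt_rank[OF _ \<open>0 \<le> D\<close>])
    fix u v assume "u \<in> range ((*v) (P - Q))"
    then have "u \<in> range ((*v) V)"
      by (auto simp: PQ matrix_vector_mul_assoc [symmetric])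
    then show "u \<bullet> (E *v v) \<le> D * norm u * norm v" by (rule D)
  qed
  also have "\<dots> \<le> D * sqrt (real (rank A) + real (rank B)) * (norm P + norm Q)"
  proof (intro mult_mono mult_left_mono \<open>0 \<le> D\<close> norm_triangle_ineq4)
    have "rank (P - Q) \<le> rank A + rank B"
      unfolding PQ using rank_mul_le_right rank_diff_le order_trans by blast
    then show "sqrt (rank (P - Q)) \<le> sqrt (real (rank A) + real (rank B))" by simp
  qed (use \<open>0 \<le> D\<close> in auto)
  finally have "2 * (E \<bullet> P) - 2 * (E \<bullet> Q) \<le> 2 * D * sqrt (real (rank A) + real (rank B)) * (norm P + norm Q)"
    by (simp add: inner_diff_right algebra_simps)
  moreover have "(norm P)\<^sup>2 + lambda * rank A \<le> (norm Q)\<^sup>2 + (2 * (E \<bullet> P) - 2 * (E \<bullet> Q)) + lambda * rank B"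
    using min unfolding res expand by simp
  ultimately show ?thesis
    unfolding P_def [symmetric] Q_def [symmetric] by (simp add: algebra_simps)
qed

section \<open>Deterministic oracle inequalities\<close>

text \<open>
  The last term is nonpositive when \<open>D \<le> sqrt lambda / (2 \<rho>)\<close>, which gives the oracle inequality for
  the squared error. It is kept here because its sign matters in expectation: the typical size
  of the noise is about half of that threshold, so the term is negative with overwhelming
  probability and pays for the rare large values of \<open>D\<close>.
\<close>

lemma squared_oracle_inequality:
  fixes a b k k0 D lambda \<rho> :: real
  assumes "a\<^sup>2 \<le> b\<^sup>2 + 2 * D * sqrt (k + k0) * (a + b) + lambda * (k0 - k)" "0 \<le> k" "0 \<le> k0"
  shows "(2 * \<rho>\<^sup>2 - 1) * a\<^sup>2 \<le> (2 * \<rho>\<^sup>2 + 1) * b\<^sup>2 + 4 * \<rho>\<^sup>2 * lambda * k0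
    + (8 * \<rho>^4 * D\<^sup>2 - 2 * \<rho>\<^sup>2 * lambda) * (k + k0)"
proof -
  define w where "w = sqrt (k + k0)"
  have w: "w\<^sup>2 = k + k0" using assms by (simp add: w_def)
  have amgm: "2 * \<rho>\<^sup>2 * (2 * D * w * z) \<le> z\<^sup>2 + 4 * \<rho>^4 * D\<^sup>2 * (k + k0)" for z
  proof -
    have "z\<^sup>2 + 4 * \<rho>^4 * D\<^sup>2 * w\<^sup>2 - 2 * \<rho>\<^sup>2 * (2 * D * w * z) = (z - 2 * \<rho>\<^sup>2 * D * w)\<^sup>2"
      by (simp add: power2_eq_square power4_eq_xxxx algebra_simps)
    then show ?thesis using w by (metis diff_ge_0_iff_ge zero_le_power2)
  qed
  have "2 * \<rho>\<^sup>2 * a\<^sup>2 \<le> 2 * \<rho>\<^sup>2 * (b\<^sup>2 + 2 * D * w * (a + b) + lambda * (k0 - k))"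
    using assms(1) by (intro mult_left_mono) (auto simp: w_def)
  also have "\<dots> = 2 * \<rho>\<^sup>2 * b\<^sup>2 + 2 * \<rho>\<^sup>2 * (2 * D * w * a) + 2 * \<rho>\<^sup>2 * (2 * D * w * b)
      + 2 * \<rho>\<^sup>2 * lambda * (k0 - k)"
    by (simp add: algebra_simps)
  also have "\<dots> \<le> 2 * \<rho>\<^sup>2 * b\<^sup>2 + (a\<^sup>2 + 4 * \<rho>^4 * D\<^sup>2 * (k + k0)) + (b\<^sup>2 + 4 * \<rho>^4 * D\<^sup>2 * (k + k0))
      + 2 * \<rho>\<^sup>2 * lambda * (k0 - k)"
    by (intro add_mono amgm order_refl)
  finally show ?thesis by (simp add: algebra_simps)
qed

text \<open>
  If \<open>a - b > 2 L\<close> then \<open>L\<^sup>2 \<le> L (a + b) / 2\<close>, so that the whole inequality can be divided by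
  \<open>a + b\<close>.
\<close>

lemma linear_from_squared_bound:
  fixes a b c w L :: real
  assumes "a\<^sup>2 \<le> b\<^sup>2 + w * (a + b) + L\<^sup>2" "0 \<le> a" "0 \<le> b" "0 \<le> w" "0 \<le> L"
  shows "a \<le> b + max (2 * L) (w + L / 2)"
proof (rule ccontr)
  assume "\<not> ?thesis"
  then have gt: "a - b > 2 * L" "a - b > w + L / 2" by auto
  have pos: "a + b > 0" using gt assms by linarith
  have "L * (2 * L) \<le> L * (a + b)" using gt assms by (intro mult_left_mono) auto
  then have "L\<^sup>2 \<le> L / 2 * (a + b)" by (simp add: power2_eq_square)
  then have "a\<^sup>2 - b\<^sup>2 \<le> (w + L / 2) * (a + b)" using assms(1) by (simp add: distrib_right)
  moreover have "a\<^sup>2 - b\<^sup>2 = (a - b) * (a + b)" by (simp add: power2_eq_square algebra_simps)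
  ultimately have "a - b \<le> w + L / 2" using pos by simp
  with gt show False by simp
qed

text \<open>
  Here \<open>k\<close>, \<open>k0\<close>, \<open>r0\<close> stand for the ranks of the estimator, of the competitor and of the true
  matrix. If \<open>k \<le> k0\<close>, then \<open>k + k0 \<le> 2 k0\<close> and the previous lemma applies with
  \<open>L = sqrt (lambda k0)\<close>. If \<open>k > k0\<close>, the penalty terms only help, but \<open>k\<close> has to be
  controlled: comparing the estimator with the true matrix gives \<open>k \<le> 5 r0 / 3\<close>, because the
  penalty for a larger rank could not be compensated by fitting the noise. Then
  \<open>(k + k0) / \<rho>\<^sup>2\<close> is at most \<open>8/3\<close> times the maximum in the conclusion.
\<close>

lemma oracle_inequality:
  fixes a b k k0 r0 D lambda \<rho> :: real
  assumes basic: "a\<^sup>2 \<le> b\<^sup>2 + 2 * D * sqrt (k + k0) * (a + b) + lambda * (k0 - k)"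
    and basic0: "a\<^sup>2 \<le> 2 * D * sqrt (k + r0) * a + lambda * (r0 - k)"
    and D: "0 \<le> D" "D \<le> sqrt lambda / (2 * \<rho>)" and "0 < lambda" "1 \<le> \<rho>"
    and nonneg: "0 \<le> a" "0 \<le> b" "0 \<le> k" "0 \<le> k0" "0 \<le> r0"
  shows "a \<le> b + 2 * sqrt (lambda * max (r0 / \<rho>\<^sup>2) k0)"
proof -
  have D_le: "2 * D \<le> sqrt lambda"
  proof -
    have "2 * D \<le> sqrt lambda / \<rho>" using D(2) \<open>1 \<le> \<rho>\<close> by (simp add: field_simps)
    also have "\<dots> \<le> sqrt lambda / 1" using assms by (intro divide_left_mono) auto
    finally show ?thesis by simp
  qed
  show ?thesis
  proof (cases "k \<le> k0")
    case True
    define L where "L = sqrt (lambda * k0)"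
    have L: "0 \<le> L" "L\<^sup>2 = lambda * k0" using assms by (auto simp: L_def)
    define w where "w = 2 * D * sqrt (k + k0)"
    have "w \<le> sqrt lambda * sqrt (2 * k0)"
      unfolding w_def using D_le True nonneg D \<open>0 < lambda\<close> by (intro mult_mono) auto
    also have "\<dots> = sqrt 2 * L" by (simp add: L_def real_sqrt_mult)
    also have "\<dots> \<le> 3 / 2 * L"
      using L by (intro mult_right_mono real_le_lsqrt) (auto simp: power2_eq_square)
    finally have w: "w \<le> 3 / 2 * L" .
    have "a\<^sup>2 \<le> b\<^sup>2 + w * (a + b) + L\<^sup>2"
    proof -
      have "lambda * (k0 - k) \<le> lambda * k0" using assms by simp
      with basic show ?thesis unfolding L w_def by linarith
    qed
    then have "a \<le> b + max (2 * L) (w + L / 2)"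
      by (rule linear_from_squared_bound) (use nonneg D L in \<open>auto simp: w_def\<close>)
    also have "max (2 * L) (w + L / 2) \<le> 2 * L" using w by simp
    also have "L \<le> sqrt (lambda * max (r0 / \<rho>\<^sup>2) k0)"
      unfolding L_def using assms by (intro real_sqrt_le_mono mult_left_mono) auto
    finally show ?thesis by simp
  next
    case False
    have k_le: "k \<le> 5 / 3 * r0"
    proof -
      have "2 * D * sqrt (k + r0) * a \<le> a\<^sup>2 + D\<^sup>2 * (k + r0)"
      proof -
        have "a\<^sup>2 + (D * sqrt (k + r0))\<^sup>2 - 2 * D * sqrt (k + r0) * a = (a - D * sqrt (k + r0))\<^sup>2"
          by (simp add: power2_diff)
        also have "\<dots> \<ge> 0" by simp
        finally show ?thesis using nonneg by (simp add: power_mult_distrib)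
      qed
      moreover have "D\<^sup>2 * (k + r0) \<le> lambda / 4 * (k + r0)"
      proof -
        have "D\<^sup>2 \<le> (sqrt lambda / 2)\<^sup>2" using D D_le by (intro power_mono) auto
        then show ?thesis using assms by (intro mult_right_mono) (auto simp: power_divide)
      qed
      ultimately have "0 \<le> lambda / 4 * (k + r0) + lambda * (r0 - k)"
        using basic0 by linarith
      also have "\<dots> = lambda * ((k + r0) / 4 + r0 - k)" by (simp add: field_simps)
      finally have "0 \<le> lambda * ((k + r0) / 4 + r0 - k)" .
      then have "0 \<le> (k + r0) / 4 + r0 - k" using \<open>0 < lambda\<close> by (simp add: zero_le_mult_iff)
      then show ?thesis by (simp add: field_simps)
    qed
    define \<mu> where "\<mu> = max (r0 / \<rho>\<^sup>2) k0"
    have \<mu>: "0 \<le> \<mu>" "r0 / \<rho>\<^sup>2 \<le> \<mu>" "k0 \<le> \<mu>" using nonneg by (auto simp: \<mu>_def)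
    have "(k + k0) / \<rho>\<^sup>2 \<le> 4 * \<mu>"
    proof -
      have "(k + k0) / \<rho>\<^sup>2 \<le> (5 / 3 * r0 + k0) / \<rho>\<^sup>2" using k_le by (simp add: divide_right_mono)
      also have "\<dots> = 5 / 3 * (r0 / \<rho>\<^sup>2) + k0 / \<rho>\<^sup>2" by (simp add: add_divide_distrib)
      also have "k0 / \<rho>\<^sup>2 \<le> k0 / 1" using assms by (intro divide_left_mono) auto
      finally show ?thesis using \<mu> by linarith
    qed
    then have sq: "sqrt (k + k0) / \<rho> \<le> 2 * sqrt \<mu>"
    proof -
      assume "(k + k0) / \<rho>\<^sup>2 \<le> 4 * \<mu>"
      then have "sqrt ((k + k0) / \<rho>\<^sup>2) \<le> sqrt (4 * \<mu>)" by (rule real_sqrt_le_mono)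
      then show ?thesis using assms by (simp add: real_sqrt_divide real_sqrt_mult)
    qed
    have w: "2 * D * sqrt (k + k0) \<le> 2 * sqrt (lambda * \<mu>)"
    proof -
      have "2 * D * sqrt (k + k0) \<le> 2 * (sqrt lambda / (2 * \<rho>)) * sqrt (k + k0)"
        using D nonneg by (intro mult_right_mono mult_left_mono) auto
      also have "\<dots> = sqrt lambda * (sqrt (k + k0) / \<rho>)" by simp
      also have "\<dots> \<le> sqrt lambda * (2 * sqrt \<mu>)" using sq assms by (intro mult_left_mono) auto
      finally show ?thesis by (simp add: real_sqrt_mult)
    qed
    have "lambda * (k0 - k) \<le> 0" using False assms by (simp add: mult_le_0_iff)
    then have "a\<^sup>2 \<le> b\<^sup>2 + 2 * D * sqrt (k + k0) * (a + b) + 0\<^sup>2" using basic by simp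
    then have "a \<le> b + max (2 * 0) (2 * D * sqrt (k + k0) + 0 / 2)"
      by (rule linear_from_squared_bound) (use nonneg D in auto)
    with w show ?thesis unfolding \<mu>_def [symmetric] using nonneg D \<mu> assms by (auto simp: max_def split: if_splits)
  qed
qed

text \<open>
  For noise of arbitrary size \<open>D\<close> the ranks are bounded by the number \<open>m\<close> of columns only. This
  is used on an event of tiny probability.
\<close>

lemma crude_oracle_inequality:
  fixes a b k k0 D lambda m :: real
  assumes basic: "a\<^sup>2 \<le> b\<^sup>2 + 2 * D * sqrt (k + k0) * (a + b) + lambda * (k0 - k)"
    and "0 \<le> D" "0 < lambda" "0 \<le> a" "0 \<le> b" "0 \<le> k" "0 \<le> k0" "k \<le> m" "k0 \<le> m"
  shows "a \<le> b + 2 * sqrt (lambda * k0) + 2 * D * sqrt (2 * m)"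
proof -
  define L where "L = sqrt (lambda * k0)"
  have L: "0 \<le> L" "L\<^sup>2 = lambda * k0" using assms by (auto simp: L_def)
  define w where "w = 2 * D * sqrt (k + k0)"
  have w: "0 \<le> w" "w \<le> 2 * D * sqrt (2 * m)"
    using assms by (auto simp: w_def intro!: mult_left_mono)
  have "lambda * (k0 - k) \<le> lambda * k0" using assms by simp
  then have "a\<^sup>2 \<le> b\<^sup>2 + w * (a + b) + L\<^sup>2" using basic unfolding L w_def by linarith
  then have "a \<le> b + max (2 * L) (w + L / 2)"
    by (rule linear_from_squared_bound) (use assms L w in auto)
  with w L show ?thesis unfolding L_def [symmetric] by linarith
qed

text \<open>
  In the application \<open>d = D\<^sup>2\<close> and \<open>5 t\<close> is the square of the noise threshold. The random rank
  \<open>k\<close> is correlated with the noise; lowering the threshold by a fifth yields a bound that is free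
  of \<open>k\<close> and still has the negative term \<open>- t k0\<close>.
\<close>

lemma noise_excess_times_rank:
  fixes d t k k0 m :: real
  assumes "0 \<le> t" "0 \<le> k" "k \<le> m" "0 \<le> k0"
  shows "(d - 5 * t) * (k + k0) \<le> (m + k0) * max 0 (d - 4 * t) - t * k0"
proof -
  have "(d - 5 * t) * (k + k0) \<le> (max 0 (d - 4 * t) - t) * (k + k0)"
    using assms by (intro mult_right_mono) auto
  also have "\<dots> = max 0 (d - 4 * t) * (k + k0) - t * k - t * k0" by (simp add: algebra_simps)
  also have "max 0 (d - 4 * t) * (k + k0) \<le> max 0 (d - 4 * t) * (m + k0)"
    using assms by (intro mult_left_mono) auto
  also have "max 0 (d - 4 * t) * (m + k0) - t * k - t * k0 \<le> (m + k0) * max 0 (d - 4 * t) - t * k0"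
    using assms by (simp add: mult.commute)
  finally show ?thesis by simp
qed

section \<open>Gaussian integrals\<close>

lemma nn_integral_exp_normal_density:
  assumes "\<sigma> > 0"
  shows "(\<integral>\<^sup>+x. ennreal (normal_density 0 \<sigma> x) * ennreal (exp (b * x)) \<partial>lborel)
    = ennreal (exp (\<sigma>\<^sup>2 * b\<^sup>2 / 2))"
proof -
  \<comment> \<open>completing the square turns the product into a multiple of a shifted normal density\<close>
  have sq: "b * x - x\<^sup>2 / (2 * \<sigma>\<^sup>2) = \<sigma>\<^sup>2 * b\<^sup>2 / 2 - (x - \<sigma>\<^sup>2 * b)\<^sup>2 / (2 * \<sigma>\<^sup>2)" for x
    using assms by (simp add: field_simps power2_eq_square)
  have "normal_density 0 \<sigma> x * exp (b * x) = exp (\<sigma>\<^sup>2 * b\<^sup>2 / 2) * normal_density (\<sigma>\<^sup>2 * b) \<sigma> x" for x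
  proof -
    have "exp (- x\<^sup>2 / (2 * \<sigma>\<^sup>2)) * exp (b * x) = exp (\<sigma>\<^sup>2 * b\<^sup>2 / 2) * exp (- (x - \<sigma>\<^sup>2 * b)\<^sup>2 / (2 * \<sigma>\<^sup>2))"
      using sq[of x] by (simp add: exp_add [symmetric] algebra_simps)
    then show ?thesis by (simp add: normal_density_def field_simps)
  qed
  then have "(\<integral>\<^sup>+x. ennreal (normal_density 0 \<sigma> x) * ennreal (exp (b * x)) \<partial>lborel)
      = (\<integral>\<^sup>+x. ennreal (exp (\<sigma>\<^sup>2 * b\<^sup>2 / 2)) * ennreal (normal_density (\<sigma>\<^sup>2 * b) \<sigma> x) \<partial>lborel)"
    by (simp add: ennreal_mult' [symmetric])
  also have "\<dots> = ennreal (exp (\<sigma>\<^sup>2 * b\<^sup>2 / 2))"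
    using assms by (simp add: nn_integral_cmult nn_integral_eq_integral normal_density_nonneg)
  finally show ?thesis .
qed

lemma nn_integral_exp_square_std_normal_density:
  assumes "\<theta> < 1"
  shows "(\<integral>\<^sup>+x. ennreal (std_normal_density x) * ennreal (exp (\<theta> * x\<^sup>2 / 2)) \<partial>lborel)
    = ennreal ((1 - \<theta>) powr (- 1 / 2))"
proof -
  \<comment> \<open>the tilted density is a multiple of the normal density with standard deviation \<open>s\<close>\<close>
  define s where "s = 1 / sqrt (1 - \<theta>)"
  have s: "s > 0" "s\<^sup>2 = 1 / (1 - \<theta>)" "s = (1 - \<theta>) powr (- 1 / 2)"
    using assms by (auto simp: s_def power_divide powr_minus_divide powr_half_sqrt)
  have "std_normal_density x * exp (\<theta> * x\<^sup>2 / 2) = s * normal_density 0 s x" for x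
  proof -
    have "exp (- x\<^sup>2 / 2) * exp (\<theta> * x\<^sup>2 / 2) = exp (- x\<^sup>2 / (2 * s\<^sup>2))"
      using assms by (simp add: exp_add [symmetric] s(2) field_simps)
    moreover have "sqrt (2 * pi * s\<^sup>2) = sqrt (2 * pi) * s"
      using s(1) by (simp add: real_sqrt_mult)
    ultimately show ?thesis
      using s(1) by (simp add: normal_density_def)
  qed
  then have "(\<integral>\<^sup>+x. ennreal (std_normal_density x) * ennreal (exp (\<theta> * x\<^sup>2 / 2)) \<partial>lborel)
      = (\<integral>\<^sup>+x. ennreal s * ennreal (normal_density 0 s x) \<partial>lborel)"
    using s(1) by (simp add: ennreal_mult' [symmetric])
  also have "\<dots> = ennreal s"
    using s(1) by (simp add: nn_integral_cmult nn_integral_eq_integral normal_density_nonneg)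
  finally show ?thesis by (simp add: s(3))
qed

abbreviation std_gaussian :: "'j set \<Rightarrow> ('j \<Rightarrow> real) measure" where
  "std_gaussian J \<equiv> PiM J (\<lambda>_. density lborel (\<lambda>x. ennreal (std_normal_density x)))"

lemma product_sigma_finite_std_normal:
  "product_sigma_finite (\<lambda>_::'j. density lborel (\<lambda>x. ennreal (std_normal_density x)))"
  using prob_space_normal_density[of 1 0]
  by (auto simp: product_sigma_finite_def prob_space_def intro: finite_measure.axioms(1))

lemma nn_integral_std_gaussian_exp_linear:
  assumes "finite J"
  shows "(\<integral>\<^sup>+y. ennreal (exp (\<Sum>j\<in>J. h j * y j)) \<partial>std_gaussian J) = ennreal (exp ((\<Sum>j\<in>J. (h j)\<^sup>2) / 2))"
proof -
  interpret product_sigma_finite "\<lambda>_::'a. density lborel (\<lambda>x. ennreal (std_normal_density x))"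
    by (rule product_sigma_finite_std_normal)
  have "(\<integral>\<^sup>+y. ennreal (exp (\<Sum>j\<in>J. h j * y j)) \<partial>std_gaussian J)
      = (\<integral>\<^sup>+y. (\<Prod>j\<in>J. ennreal (exp (h j * y j))) \<partial>std_gaussian J)"
    using assms by (simp add: exp_sum prod_ennreal)
  also have "\<dots> = (\<Prod>j\<in>J. ennreal (exp ((h j)\<^sup>2 / 2)))"
    using nn_integral_exp_normal_density[of 1]
    by (subst product_nn_integral_prod) (auto simp: assms nn_integral_density)
  also have "\<dots> = ennreal (exp ((\<Sum>j\<in>J. (h j)\<^sup>2) / 2))"
    using assms by (simp add: exp_sum prod_ennreal sum_divide_distrib)
  finally show ?thesis .
qed

lemma nn_integral_std_gaussian_exp_square:
  assumes "finite J" "\<theta> < 1"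
  shows "(\<integral>\<^sup>+y. ennreal (exp (\<theta> * (\<Sum>j\<in>J. (y j)\<^sup>2) / 2)) \<partial>std_gaussian J)
    = ennreal ((1 - \<theta>) powr (- real (card J) / 2))"
proof -
  interpret product_sigma_finite "\<lambda>_::'a. density lborel (\<lambda>x. ennreal (std_normal_density x))"
    by (rule product_sigma_finite_std_normal)
  have "(\<integral>\<^sup>+y. ennreal (exp (\<theta> * (\<Sum>j\<in>J. (y j)\<^sup>2) / 2)) \<partial>std_gaussian J)
      = (\<integral>\<^sup>+y. (\<Prod>j\<in>J. ennreal (exp (\<theta> * (y j)\<^sup>2 / 2))) \<partial>std_gaussian J)"
    using assms by (simp add: exp_sum prod_ennreal sum_distrib_left sum_divide_distrib)
  also have "\<dots> = (\<Prod>j\<in>J. ennreal ((1 - \<theta>) powr (- 1 / 2)))"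
    using nn_integral_exp_square_std_normal_density[OF assms(2)]
    by (subst product_nn_integral_prod) (auto simp: assms nn_integral_density)
  also have "\<dots> = ennreal (((1 - \<theta>) powr (- 1 / 2)) ^ card J)"
    by (simp add: ennreal_power)
  also have "((1 - \<theta>) powr (- 1 / 2)) ^ card J = (1 - \<theta>) powr (- real (card J) / 2)"
    using assms(2) by (simp add: powr_power)
  finally show ?thesis .
qed

section \<open>Exponential integrals over a ball\<close>

text \<open>
  Balls and Gaussian vectors are taken in products indexed by a finite set rather than in a
  Euclidean space type, since the dimension needed later is the rank of a matrix.
\<close>

lemma nn_integral_PiM_lborel_affine:
  fixes t :: "'i \<Rightarrow> real"
  assumes "finite I" "c \<noteq> 0" "f \<in> borel_measurable (PiM I (\<lambda>_. lborel))"
  shows "(\<integral>\<^sup>+x. f x \<partial>PiM I (\<lambda>_. lborel))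
    = ennreal (\<bar>c\<bar> ^ card I) * (\<integral>\<^sup>+x. f (\<lambda>i\<in>I. t i + c * x i) \<partial>PiM I (\<lambda>_. lborel))"
  using assms(1,3)
proof (induction I arbitrary: f rule: finite_induct)
  case empty
  then show ?case
    by (simp add: PiM_empty nn_integral_count_space_finite)
next
  case (insert i I)
  interpret product_sigma_finite "\<lambda>_::'i. lborel :: real measure" ..
  note [measurable] = insert.prems
  have m1: "(\<lambda>x. \<integral>\<^sup>+ y. f (x(i := y)) \<partial>lborel) \<in> borel_measurable (PiM I (\<lambda>_. lborel))"
    by measurable
  have m2: "(\<lambda>y. f (x(i := y))) \<in> borel_measurable borel" if "x \<in> space (PiM I (\<lambda>_. lborel))" for x
  proof -
    have "(\<lambda>y. x(i := y)) \<in> lborel \<rightarrow>\<^sub>M PiM (insert i I) (\<lambda>_. lborel)"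
      using measurable_component_update[OF that insert.hyps(2)] by simp
    from measurable_comp[OF this insert.prems] show ?thesis by (simp add: comp_def)
  qed
  have upd: "(\<lambda>k\<in>insert i I. t k + c * (x(i := y)) k) = (\<lambda>k\<in>I. t k + c * x k)(i := t i + c * y)" for x y
    using insert.hyps(2) by (auto simp: fun_eq_iff restrict_def)
  have "(\<integral>\<^sup>+x. f x \<partial>PiM (insert i I) (\<lambda>_. lborel))
      = (\<integral>\<^sup>+ x. \<integral>\<^sup>+ y. f (x(i := y)) \<partial>lborel \<partial>PiM I (\<lambda>_. lborel))"
    by (rule product_nn_integral_insert[OF insert.hyps insert.prems])
  also have "\<dots> = ennreal (\<bar>c\<bar> ^ card I) *
      (\<integral>\<^sup>+ x. \<integral>\<^sup>+ y. f ((\<lambda>i\<in>I. t i + c * x i)(i := y)) \<partial>lborel \<partial>PiM I (\<lambda>_. lborel))"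
    by (rule insert.IH[OF m1])
  also have "(\<integral>\<^sup>+ x. \<integral>\<^sup>+ y. f ((\<lambda>i\<in>I. t i + c * x i)(i := y)) \<partial>lborel \<partial>PiM I (\<lambda>_. lborel))
     = (\<integral>\<^sup>+ x. ennreal \<bar>c\<bar> * (\<integral>\<^sup>+ y. f (\<lambda>k\<in>insert i I. t k + c * (x(i := y)) k) \<partial>lborel) \<partial>PiM I (\<lambda>_. lborel))"
    unfolding upd
    by (intro nn_integral_cong nn_integral_real_affine[OF m2 assms(2)])
       (auto simp: space_PiM)
  also have "\<dots> = ennreal \<bar>c\<bar> * (\<integral>\<^sup>+ x. \<integral>\<^sup>+ y. f (\<lambda>k\<in>insert i I. t k + c * (x(i := y)) k) \<partial>lborel \<partial>PiM I (\<lambda>_. lborel))"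
    by (rule nn_integral_cmult) measurable
  also have "(\<integral>\<^sup>+ x. \<integral>\<^sup>+ y. f (\<lambda>k\<in>insert i I. t k + c * (x(i := y)) k) \<partial>lborel \<partial>PiM I (\<lambda>_. lborel))
     = (\<integral>\<^sup>+x. f (\<lambda>k\<in>insert i I. t k + c * x k) \<partial>PiM (insert i I) (\<lambda>_. lborel))"
    by (rule product_nn_integral_insert[OF insert.hyps, symmetric]) measurable
  finally have "(\<integral>\<^sup>+x. f x \<partial>PiM (insert i I) (\<lambda>_. lborel)) = ennreal (\<bar>c\<bar> ^ card I) *
    (ennreal \<bar>c\<bar> * (\<integral>\<^sup>+x. f (\<lambda>k\<in>insert i I. t k + c * x k) \<partial>PiM (insert i I) (\<lambda>_. lborel)))" .
  moreover have "ennreal (\<bar>c\<bar> ^ card (insert i I)) = ennreal (\<bar>c\<bar> ^ card I) * ennreal \<bar>c\<bar>"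
    using insert.hyps by (simp add: ennreal_mult' mult.commute)
  ultimately show ?case
    by (simp only: mult.assoc)
qed

abbreviation coord_ball :: "'i set \<Rightarrow> ('i \<Rightarrow> real) set" where
  "coord_ball I \<equiv> {x. (\<Sum>i\<in>I. (x i)\<^sup>2) \<le> 1}"

definition ball_volume :: "'i set \<Rightarrow> ennreal" where
  "ball_volume I = (\<integral>\<^sup>+x. indicator (coord_ball I) x \<partial>PiM I (\<lambda>_. lborel))"

lemma indicator_coord_ball_measurable [measurable]:
  "(indicator (coord_ball I) :: _ \<Rightarrow> ennreal) \<in> borel_measurable (PiM I (\<lambda>_. lborel))"
  by measurable

lemma ball_volume_finite:
  assumes "finite I" shows "ball_volume I < \<infinity>"
proof -
  interpret product_sigma_finite "\<lambda>_::'a. lborel :: real measure" ..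
  have cube: "- 1 \<le> x j \<and> x j \<le> 1" if "(\<Sum>i\<in>I. (x i)\<^sup>2) \<le> 1" "j \<in> I" for x :: "'a \<Rightarrow> real" and j
  proof -
    have "(x j)\<^sup>2 \<le> (\<Sum>i\<in>I. (x i)\<^sup>2)"
      using assms that(2) by (intro member_le_sum) auto
    with that(1) have "(x j)\<^sup>2 \<le> 1" by simp
    then show ?thesis by (simp add: abs_square_le_1 abs_le_iff minus_le_iff)
  qed
  have "ball_volume I \<le> (\<integral>\<^sup>+x. indicator (PiE I (\<lambda>_. {-1..1::real})) x \<partial>PiM I (\<lambda>_. lborel))"
    unfolding ball_volume_def
    by (intro nn_integral_mono) (auto simp: indicator_def space_PiM PiE_iff cube)
  also have "\<dots> = emeasure (PiM I (\<lambda>_. lborel)) (PiE I (\<lambda>_. {-1..1::real}))"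
    using assms by (intro nn_integral_indicator sets_PiM_I_finite) auto
  also have "\<dots> = (\<Prod>i\<in>I. emeasure lborel {-1..1::real})"
    using assms by (intro emeasure_PiM) auto
  also have "\<dots> < \<infinity>"
    by (simp add: power_less_top_ennreal)
  finally show ?thesis .
qed

lemma ball_volume_pos:
  assumes "finite I" shows "0 < ball_volume I"
proof -
  interpret product_sigma_finite "\<lambda>_::'a. lborel :: real measure" ..
  define d where "d = 1 / (1 + real (card I))"
  have d: "0 < d" "d \<le> 1" "real (card I) * d \<le> 1"
    by (auto simp: d_def field_simps)
  have ball: "x \<in> coord_ball I" if "\<And>i. i \<in> I \<Longrightarrow> - d \<le> x i \<and> x i \<le> d" for x
  proof -
    have "(x i)\<^sup>2 \<le> d" if "i \<in> I" for i
    proof -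
      have "(x i)\<^sup>2 \<le> d\<^sup>2"
        using \<open>\<And>i. i \<in> I \<Longrightarrow> - d \<le> x i \<and> x i \<le> d\<close>[OF that] d by (intro abs_le_square_iff[THEN iffD1]) auto
      also have "\<dots> \<le> d" using d by (simp add: power2_eq_square mult_left_le)
      finally show ?thesis .
    qed
    then have "(\<Sum>i\<in>I. (x i)\<^sup>2) \<le> (\<Sum>i\<in>I. d)" by (rule sum_mono)
    with d show ?thesis by simp
  qed
  have "0 < ennreal ((2 * d) ^ card I)"
    using d by simp
  also have "\<dots> = (\<Prod>i\<in>I. emeasure lborel {-d..d})"
    using assms d by (simp add: ennreal_power)
  also have "\<dots> = emeasure (PiM I (\<lambda>_. lborel)) (PiE I (\<lambda>_. {-d..d}))"
    using assms by (intro emeasure_PiM[symmetric]) auto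
  also have "\<dots> = (\<integral>\<^sup>+x. indicator (PiE I (\<lambda>_. {-d..d})) x \<partial>PiM I (\<lambda>_. lborel))"
    using assms by (intro nn_integral_indicator[symmetric] sets_PiM_I_finite) auto
  also have "\<dots> \<le> ball_volume I"
    unfolding ball_volume_def
    by (intro nn_integral_mono) (auto simp: indicator_def PiE_iff intro!: ball[simplified])
  finally show ?thesis .
qed

text \<open>
  The reflection \<open>x \<mapsto> - x\<close> preserves the ball, so the integrand may be averaged to a hyperbolic
  cosine.
\<close>

lemma ball_volume_le_integral_exp:
  assumes "finite I"
  shows "ball_volume I \<le> (\<integral>\<^sup>+x. indicator (coord_ball I) x * ennreal (exp (\<Sum>i\<in>I. \<alpha> i * x i)) \<partial>PiM I (\<lambda>_. lborel))"
    (is "_ \<le> ?J")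
proof -
  let ?L = "PiM I (\<lambda>_. lborel :: real measure)"
  let ?f = "\<lambda>x. indicator (coord_ball I) x * ennreal (exp (\<Sum>i\<in>I. \<alpha> i * x i))"
  let ?g = "\<lambda>x. indicator (coord_ball I) x * ennreal (exp (- (\<Sum>i\<in>I. \<alpha> i * x i)))"
  have "?J = ennreal (\<bar>- 1\<bar> ^ card I) * (\<integral>\<^sup>+x. ?f (\<lambda>i\<in>I. 0 + (- 1) * x i) \<partial>?L)"
    by (rule nn_integral_PiM_lborel_affine) (auto simp: assms)
  also have "\<dots> = (\<integral>\<^sup>+x. ?g x \<partial>?L)"
    by (auto simp: indicator_def sum_negf intro!: nn_integral_cong)
  finally have flip: "?J = (\<integral>\<^sup>+x. ?g x \<partial>?L)" .
  have cosh: "2 \<le> ennreal (exp s) + ennreal (exp (- s))" for s :: real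
  proof -
    have "2 \<le> exp s + exp (- s)"
      using exp_ge_add_one_self[of s] exp_ge_add_one_self[of "- s"] by linarith
    then have "ennreal 2 \<le> ennreal (exp s + exp (- s))" by (rule ennreal_leI)
    then show ?thesis by simp
  qed
  have "2 * ball_volume I = (\<integral>\<^sup>+x. indicator (coord_ball I) x * 2 \<partial>?L)"
    unfolding ball_volume_def by (subst nn_integral_multc) (auto simp: mult.commute)
  also have "\<dots> \<le> (\<integral>\<^sup>+x. ?f x + ?g x \<partial>?L)"
    by (intro nn_integral_mono) (auto simp: distrib_left [symmetric] intro!: mult_left_mono cosh)
  also have "\<dots> = ?J + (\<integral>\<^sup>+x. ?g x \<partial>?L)"
    by (rule nn_integral_add) measurable
  also have "\<dots> = 2 * ?J"
    unfolding flip [symmetric] by (rule mult_2 [symmetric])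
  finally show ?thesis
    by (simp add: ennreal_mult_le_mult_iff)
qed

text \<open>
  The ball contains the copy of itself shrunk by the factor \<open>1 - c\<close> around \<open>c a\<close>. On this copy the
  exponent is \<open>c\<close> times its value at \<open>a\<close> plus a linear form in the deviation, and the latter
  does not decrease the integral by the previous lemma. The volume factor \<open>(1 - c) ^ card I\<close> is
  the price of knowing \<open>a\<close> up to a constant only, and plays the part of the cardinality of a net.
\<close>

lemma ball_integral_exp_ge:
  assumes "finite I" "0 \<le> c" "c < 1" "a \<in> coord_ball I"
  shows "ennreal ((1 - c) ^ card I) * ennreal (exp (c * (\<Sum>i\<in>I. \<alpha> i * a i))) * ball_volume I
    \<le> (\<integral>\<^sup>+x. indicator (coord_ball I) x * ennreal (exp (\<Sum>i\<in>I. \<alpha> i * x i)) \<partial>PiM I (\<lambda>_. lborel))"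
    (is "_ \<le> ?J")
proof -
  let ?L = "PiM I (\<lambda>_. lborel :: real measure)"
  let ?f = "\<lambda>x. indicator (coord_ball I) x * ennreal (exp (\<Sum>i\<in>I. \<alpha> i * x i))"
  have conv: "(\<lambda>i\<in>I. c * a i + (1 - c) * x i) \<in> coord_ball I" if "x \<in> coord_ball I" for x
  proof -
    have "(c * a i + (1 - c) * x i)\<^sup>2 \<le> c * (a i)\<^sup>2 + (1 - c) * (x i)\<^sup>2" for i
    proof -
      have "c * (a i)\<^sup>2 + (1 - c) * (x i)\<^sup>2 - (c * a i + (1 - c) * x i)\<^sup>2 = c * (1 - c) * (a i - x i)\<^sup>2"
        by (simp add: power2_eq_square algebra_simps)
      also have "\<dots> \<ge> 0" using assms by simp
      finally show ?thesis by linarith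
    qed
    then have "(\<Sum>i\<in>I. (c * a i + (1 - c) * x i)\<^sup>2) \<le> c * (\<Sum>i\<in>I. (a i)\<^sup>2) + (1 - c) * (\<Sum>i\<in>I. (x i)\<^sup>2)"
      by (simp add: sum_distrib_left sum.distrib [symmetric] sum_mono)
    also have "\<dots> \<le> c * 1 + (1 - c) * 1"
      using assms that by (intro add_mono mult_left_mono) auto
    finally show ?thesis by simp
  qed
  have "ennreal (exp (c * (\<Sum>i\<in>I. \<alpha> i * a i))) * ball_volume I
      \<le> ennreal (exp (c * (\<Sum>i\<in>I. \<alpha> i * a i))) *
        (\<integral>\<^sup>+x. indicator (coord_ball I) x * ennreal (exp (\<Sum>i\<in>I. ((1 - c) * \<alpha> i) * x i)) \<partial>?L)"
    by (intro mult_left_mono ball_volume_le_integral_exp assms) auto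
  also have "\<dots> = (\<integral>\<^sup>+x. ennreal (exp (c * (\<Sum>i\<in>I. \<alpha> i * a i))) *
        (indicator (coord_ball I) x * ennreal (exp (\<Sum>i\<in>I. ((1 - c) * \<alpha> i) * x i))) \<partial>?L)"
    by (rule nn_integral_cmult [symmetric]) measurable
  also have "\<dots> \<le> (\<integral>\<^sup>+x. ?f (\<lambda>i\<in>I. c * a i + (1 - c) * x i) \<partial>?L)"
  proof (rule nn_integral_mono)
    fix x :: "'a \<Rightarrow> real"
    have e: "exp (c * (\<Sum>i\<in>I. \<alpha> i * a i)) * exp (\<Sum>i\<in>I. ((1 - c) * \<alpha> i) * x i)
        = exp (\<Sum>i\<in>I. \<alpha> i * (\<lambda>i\<in>I. c * a i + (1 - c) * x i) i)"
      by (simp add: exp_add [symmetric] sum_distrib_left sum.distrib [symmetric] algebra_simps)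
    show "ennreal (exp (c * (\<Sum>i\<in>I. \<alpha> i * a i))) *
        (indicator (coord_ball I) x * ennreal (exp (\<Sum>i\<in>I. ((1 - c) * \<alpha> i) * x i)))
      \<le> ?f (\<lambda>i\<in>I. c * a i + (1 - c) * x i)"
    proof (cases "x \<in> coord_ball I")
      case True
      with conv[OF True] show ?thesis
        by (simp only: indicator_simps mult_1 ennreal_mult' [symmetric] exp_ge_zero e order_refl)
    qed (simp add: indicator_def)
  qed
  finally have "ennreal ((1 - c) ^ card I) * (ennreal (exp (c * (\<Sum>i\<in>I. \<alpha> i * a i))) * ball_volume I)
      \<le> ennreal ((1 - c) ^ card I) * (\<integral>\<^sup>+x. ?f (\<lambda>i\<in>I. c * a i + (1 - c) * x i) \<partial>?L)"
    by (rule mult_left_mono) simp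
  also have "\<dots> = ?J"
    using assms nn_integral_PiM_lborel_affine[of I "1 - c" ?f "\<lambda>i. c * a i"] by simp
  finally show ?thesis by (simp add: mult.assoc)
qed

section \<open>The norm of a Gaussian bilinear form\<close>

text \<open>
  A covering argument with integrals in place of nets. Up to a constant, \<open>W\<close> is the average of
  \<open>exp (sqrt \<theta> F x y)\<close>, \<open>F\<close> the bilinear form with coefficients \<open>g\<close>, over \<open>x\<close> uniform in the ball
  and \<open>y\<close> standard Gaussian. Its mean is computed by exchanging the integrals: for fixed \<open>x\<close>,
  \<open>y\<close> the mean of the exponential is at most \<open>exp (\<theta> \<bar>y\<bar>\<^sup>2 / 2)\<close>. Conversely, at each point of
  the probability space \<open>W\<close> dominates the contribution of the \<open>x\<close> near any chosen direction \<open>a\<close>,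
  and integrating the exponential of a linear form in \<open>y\<close> produces its squared norm. Since \<open>a\<close> is
  arbitrary and may depend on the sample, this controls the supremum over \<open>a\<close>.
\<close>

lemma gaussian_bilinear_exp_moment:
  fixes g :: "'i \<Rightarrow> 'j \<Rightarrow> 'w \<Rightarrow> real"
  assumes "sigma_finite_measure M" "finite I" "finite J" "0 < \<theta>" "\<theta> < 1" "0 \<le> c" "c < 1"
    and g [measurable]: "\<And>i j. g i j \<in> borel_measurable M"
    and mgf: "\<And>x y. (\<integral>\<^sup>+\<omega>. ennreal (exp (\<Sum>i\<in>I. \<Sum>j\<in>J. x i * y j * g i j \<omega>)) \<partial>M)
      = ennreal (exp ((\<Sum>i\<in>I. (x i)\<^sup>2) * (\<Sum>j\<in>J. (y j)\<^sup>2) / 2))"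
  obtains W where "W \<in> borel_measurable M"
    and "\<And>\<omega> a. a \<in> coord_ball I \<Longrightarrow>
      ennreal (exp (\<theta> * c\<^sup>2 * (\<Sum>j\<in>J. (\<Sum>i\<in>I. a i * g i j \<omega>)\<^sup>2) / 2)) \<le> W \<omega>"
    and "(\<integral>\<^sup>+\<omega>. W \<omega> \<partial>M) \<le> ennreal ((1 - \<theta>) powr (- real (card J) / 2) / (1 - c) ^ card I)"
proof -
  interpret M: sigma_finite_measure M by fact
  interpret L: finite_product_sigma_finite "\<lambda>_::'i. lborel :: real measure" I
    by standard (rule assms)
  interpret N: product_sigma_finite "\<lambda>_::'j. density lborel (\<lambda>x. ennreal (std_normal_density x))"
    by (rule product_sigma_finite_std_normal)
  interpret N: finite_product_sigma_finite "\<lambda>_::'j. density lborel (\<lambda>x. ennreal (std_normal_density x))" J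
    by standard (rule assms)
  let ?L = "PiM I (\<lambda>_::'i. lborel :: real measure)"
  let ?N = "std_gaussian J"
  define F where "F \<omega> y x = (\<Sum>i\<in>I. \<Sum>j\<in>J. (sqrt \<theta> * x i) * y j * g i j \<omega>)" for \<omega> y x
  \<comment> \<open>normalizes by the volume of the shrunken ball\<close>
  define K where "K = 1 / (enn2real (ball_volume I) * (1 - c) ^ card I)"
  define W0 where "W0 \<omega> = (\<integral>\<^sup>+y. \<integral>\<^sup>+x. indicator (coord_ball I) x * ennreal (exp (F \<omega> y x)) \<partial>?L \<partial>?N)" for \<omega>
  have vol: "ball_volume I = ennreal (enn2real (ball_volume I))" "0 < enn2real (ball_volume I)"
    using ball_volume_finite[OF assms(2)] ball_volume_pos[OF assms(2)]
    by (auto simp: enn2real_positive_iff)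
  have K: "K > 0" using vol(2) assms by (simp add: K_def)
  have Fm [measurable (raw)]: "(\<lambda>z. F (w z) (b z) (d z)) \<in> borel_measurable Z"
    if [measurable]: "w \<in> Z \<rightarrow>\<^sub>M M" "b \<in> Z \<rightarrow>\<^sub>M ?N" "d \<in> Z \<rightarrow>\<^sub>M ?L"
    for Z :: "'z measure" and w b d
  proof -
    have "(\<lambda>z. g i j (w z)) \<in> borel_measurable Z" for i j
      using measurable_compose[OF that(1) g] .
    moreover have "(\<lambda>z. d z i) \<in> borel_measurable Z" if "i \<in> I" for i
      using measurable_compose[OF \<open>d \<in> Z \<rightarrow>\<^sub>M ?L\<close> measurable_component_singleton[OF that]] by simp
    moreover have "(\<lambda>z. b z j) \<in> borel_measurable Z" if "j \<in> J" for j
      using measurable_compose[OF \<open>b \<in> Z \<rightarrow>\<^sub>M ?N\<close> measurable_component_singleton[OF that]] by simp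
    ultimately show ?thesis
      unfolding F_def by (intro borel_measurable_sum borel_measurable_times borel_measurable_const)
  qed
  have W0m [measurable]: "W0 \<in> borel_measurable M"
    unfolding W0_def by measurable
  show thesis
  proof
    show "(\<lambda>\<omega>. ennreal K * W0 \<omega>) \<in> borel_measurable M" by measurable
  next
    fix \<omega> a assume a: "a \<in> coord_ball I"
    define h where "h j = (\<Sum>i\<in>I. a i * g i j \<omega>)" for j
    have lower: "ennreal ((1 - c) ^ card I) * ennreal (exp (\<Sum>j\<in>J. sqrt \<theta> * c * h j * y j)) * ball_volume I
        \<le> (\<integral>\<^sup>+x. indicator (coord_ball I) x * ennreal (exp (F \<omega> y x)) \<partial>?L)" for y
    proof -
      define \<alpha> where "\<alpha> i = (\<Sum>j\<in>J. sqrt \<theta> * y j * g i j \<omega>)" for i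
      have "F \<omega> y x = (\<Sum>i\<in>I. \<alpha> i * x i)" for x
        by (simp add: F_def \<alpha>_def sum_distrib_right sum_distrib_left mult_ac)
      moreover have "c * (\<Sum>i\<in>I. \<alpha> i * a i) = (\<Sum>j\<in>J. sqrt \<theta> * c * h j * y j)"
      proof -
        have "c * (\<Sum>i\<in>I. \<alpha> i * a i) = (\<Sum>i\<in>I. \<Sum>j\<in>J. c * (sqrt \<theta> * y j * g i j \<omega>) * a i)"
          by (simp add: \<alpha>_def sum_distrib_right sum_distrib_left mult_ac)
        also have "\<dots> = (\<Sum>j\<in>J. \<Sum>i\<in>I. c * (sqrt \<theta> * y j * g i j \<omega>) * a i)" by (rule sum.swap)
        also have "\<dots> = (\<Sum>j\<in>J. sqrt \<theta> * c * h j * y j)"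
          by (simp add: h_def sum_distrib_right sum_distrib_left mult_ac)
        finally show ?thesis .
      qed
      ultimately show ?thesis
        using ball_integral_exp_ge[OF assms(2,6,7) a, of \<alpha>] by simp
    qed
    have "ennreal ((1 - c) ^ card I) * ball_volume I * ennreal (exp (\<theta> * c\<^sup>2 * (\<Sum>j\<in>J. (h j)\<^sup>2) / 2))
        = ennreal ((1 - c) ^ card I) * ball_volume I * (\<integral>\<^sup>+y. ennreal (exp (\<Sum>j\<in>J. sqrt \<theta> * c * h j * y j)) \<partial>?N)"
      using assms(4) by (simp add: nn_integral_std_gaussian_exp_linear assms(3) power_mult_distrib sum_distrib_left)
    also have "\<dots> = (\<integral>\<^sup>+y. ennreal ((1 - c) ^ card I) * ball_volume I * ennreal (exp (\<Sum>j\<in>J. sqrt \<theta> * c * h j * y j)) \<partial>?N)"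
      by (rule nn_integral_cmult [symmetric]) measurable
    also have "\<dots> \<le> W0 \<omega>"
      unfolding W0_def by (intro nn_integral_mono) (use lower in \<open>simp add: mult_ac\<close>)
    finally have "ennreal K * (ennreal ((1 - c) ^ card I) * ball_volume I * ennreal (exp (\<theta> * c\<^sup>2 * (\<Sum>j\<in>J. (h j)\<^sup>2) / 2)))
        \<le> ennreal K * W0 \<omega>"
      by (rule mult_left_mono) simp
    also have "ennreal K * (ennreal ((1 - c) ^ card I) * ball_volume I * ennreal (exp (\<theta> * c\<^sup>2 * (\<Sum>j\<in>J. (h j)\<^sup>2) / 2)))
        = ennreal (exp (\<theta> * c\<^sup>2 * (\<Sum>j\<in>J. (h j)\<^sup>2) / 2))"
      using vol(2) assms K by (subst vol(1)) (simp add: ennreal_mult' [symmetric] K_def)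
    finally show "ennreal (exp (\<theta> * c\<^sup>2 * (\<Sum>j\<in>J. (\<Sum>i\<in>I. a i * g i j \<omega>)\<^sup>2) / 2)) \<le> ennreal K * W0 \<omega>"
      by (simp add: h_def)
  next
    interpret MG: pair_sigma_finite M ?N
      by standard
    interpret MB: pair_sigma_finite M ?L
      by standard
    have in_ball: "indicator (coord_ball I) x * ennreal (exp (\<theta> * (\<Sum>i\<in>I. (x i)\<^sup>2) * (\<Sum>j\<in>J. (y j)\<^sup>2) / 2))
        \<le> indicator (coord_ball I) x * ennreal (exp (\<theta> * (\<Sum>j\<in>J. (y j)\<^sup>2) / 2))" for x y
    proof (cases "x \<in> coord_ball I")
      case True
      have "\<theta> * (\<Sum>i\<in>I. (x i)\<^sup>2) * (\<Sum>j\<in>J. (y j)\<^sup>2) \<le> \<theta> * 1 * (\<Sum>j\<in>J. (y j)\<^sup>2)"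
        using True assms(4) by (intro mult_right_mono mult_left_mono sum_nonneg) auto
      then show ?thesis by (intro mult_left_mono ennreal_leI) auto
    qed simp
    have mgfF: "(\<integral>\<^sup>+\<omega>. ennreal (exp (F \<omega> y x)) \<partial>M)
        = ennreal (exp (\<theta> * (\<Sum>i\<in>I. (x i)\<^sup>2) * (\<Sum>j\<in>J. (y j)\<^sup>2) / 2))" for x y
      using mgf[of "\<lambda>i. sqrt \<theta> * x i" y] assms(4)
      by (simp add: F_def power_mult_distrib sum_distrib_left [symmetric])
    have "(\<integral>\<^sup>+\<omega>. W0 \<omega> \<partial>M)
        = (\<integral>\<^sup>+y. \<integral>\<^sup>+\<omega>. \<integral>\<^sup>+x. indicator (coord_ball I) x * ennreal (exp (F \<omega> y x)) \<partial>?L \<partial>M \<partial>?N)"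
      unfolding W0_def by (rule MG.Fubini' [symmetric]) measurable
    also have "\<dots> = (\<integral>\<^sup>+y. \<integral>\<^sup>+x. \<integral>\<^sup>+\<omega>. indicator (coord_ball I) x * ennreal (exp (F \<omega> y x)) \<partial>M \<partial>?L \<partial>?N)"
      by (intro nn_integral_cong MB.Fubini' [symmetric]) measurable
    also have "\<dots> \<le> (\<integral>\<^sup>+y. \<integral>\<^sup>+x. indicator (coord_ball I) x * ennreal (exp (\<theta> * (\<Sum>j\<in>J. (y j)\<^sup>2) / 2)) \<partial>?L \<partial>?N)"
    proof (intro nn_integral_mono)
      fix y x assume [measurable]: "y \<in> space ?N" "x \<in> space ?L"
      have "(\<integral>\<^sup>+\<omega>. indicator (coord_ball I) x * ennreal (exp (F \<omega> y x)) \<partial>M)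
          = indicator (coord_ball I) x * (\<integral>\<^sup>+\<omega>. ennreal (exp (F \<omega> y x)) \<partial>M)"
        unfolding F_def by (rule nn_integral_cmult) measurable
      also have "\<dots> \<le> indicator (coord_ball I) x * ennreal (exp (\<theta> * (\<Sum>j\<in>J. (y j)\<^sup>2) / 2))"
        unfolding mgfF by (rule in_ball)
      finally show "(\<integral>\<^sup>+\<omega>. indicator (coord_ball I) x * ennreal (exp (F \<omega> y x)) \<partial>M) \<le> \<dots>" .
    qed
    also have "\<dots> = (\<integral>\<^sup>+y. ball_volume I * ennreal (exp (\<theta> * (\<Sum>j\<in>J. (y j)\<^sup>2) / 2)) \<partial>?N)"
      unfolding ball_volume_def by (intro nn_integral_cong nn_integral_multc) measurable
    also have "\<dots> = ball_volume I * (\<integral>\<^sup>+y. ennreal (exp (\<theta> * (\<Sum>j\<in>J. (y j)\<^sup>2) / 2)) \<partial>?N)"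
      by (rule nn_integral_cmult) measurable
    also have "\<dots> = ball_volume I * ennreal ((1 - \<theta>) powr (- real (card J) / 2))"
      by (simp add: nn_integral_std_gaussian_exp_square assms)
    finally have "ennreal K * (\<integral>\<^sup>+\<omega>. W0 \<omega> \<partial>M) \<le> ennreal K * (ball_volume I * ennreal ((1 - \<theta>) powr (- real (card J) / 2)))"
      by (rule mult_left_mono) simp
    also have "\<dots> = ennreal ((1 - \<theta>) powr (- real (card J) / 2) / (1 - c) ^ card I)"
      using vol(2) K by (subst vol(1)) (simp add: ennreal_mult' [symmetric] K_def)
    finally show "(\<integral>\<^sup>+\<omega>. ennreal K * W0 \<omega> \<partial>M) \<le> ennreal ((1 - \<theta>) powr (- real (card J) / 2) / (1 - c) ^ card I)"
      by (simp add: nn_integral_cmult)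
  qed
qed

text \<open>
  The lower bound on \<open>W\<close> is solved for the bilinear form: \<open>D\<close> is chosen such that
  \<open>exp (\<theta> c\<^sup>2 D\<^sup>2 / 2) = W\<close>. It bounds the norm of the form wherever \<open>W\<close> is finite, hence almost
  surely. Working with a measurable bound avoids the norm itself, a supremum over an
  uncountable set.
\<close>

lemma gaussian_bilinear_norm:
  fixes g :: "'i \<Rightarrow> 'j \<Rightarrow> 'w \<Rightarrow> real"
  assumes "sigma_finite_measure M" "finite I" "finite J" "0 < \<theta>" "\<theta> < 1" "0 < c" "c < 1"
    and g: "\<And>i j. g i j \<in> borel_measurable M"
    and mgf: "\<And>x y. (\<integral>\<^sup>+\<omega>. ennreal (exp (\<Sum>i\<in>I. \<Sum>j\<in>J. x i * y j * g i j \<omega>)) \<partial>M)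
      = ennreal (exp ((\<Sum>i\<in>I. (x i)\<^sup>2) * (\<Sum>j\<in>J. (y j)\<^sup>2) / 2))"
  obtains D where "D \<in> borel_measurable M" "\<And>\<omega>. 0 \<le> D \<omega>"
    and "AE \<omega> in M. \<forall>x y. (\<Sum>i\<in>I. \<Sum>j\<in>J. x i * y j * g i j \<omega>)
      \<le> D \<omega> * sqrt (\<Sum>i\<in>I. (x i)\<^sup>2) * sqrt (\<Sum>j\<in>J. (y j)\<^sup>2)"
    and "(\<integral>\<^sup>+\<omega>. ennreal (exp (\<theta> * c\<^sup>2 * (D \<omega>)\<^sup>2 / 2)) \<partial>M)
      \<le> ennreal ((1 - \<theta>) powr (- real (card J) / 2) / (1 - c) ^ card I)"
proof -
  have "0 \<le> c" using assms by simp
  obtain W where W [measurable]: "W \<in> borel_measurable M"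
    and lower: "\<And>\<omega> a. a \<in> coord_ball I \<Longrightarrow>
      ennreal (exp (\<theta> * c\<^sup>2 * (\<Sum>j\<in>J. (\<Sum>i\<in>I. a i * g i j \<omega>)\<^sup>2) / 2)) \<le> W \<omega>"
    and upper: "(\<integral>\<^sup>+\<omega>. W \<omega> \<partial>M) \<le> ennreal ((1 - \<theta>) powr (- real (card J) / 2) / (1 - c) ^ card I)"
    by (rule gaussian_bilinear_exp_moment[OF assms(1-5) \<open>0 \<le> c\<close> assms(7) g mgf]) blast
  define \<kappa> where "\<kappa> = \<theta> * c\<^sup>2 / 2"
  have \<kappa>: "\<kappa> > 0" using assms by (simp add: \<kappa>_def)
  \<comment> \<open>the maximum only serves the null set where \<open>W\<close> is infinite and \<open>enn2real\<close> returns 0\<close>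
  define D where "D \<omega> = sqrt (ln (max 1 (enn2real (W \<omega>))) / \<kappa>)" for \<omega>
  have expD: "exp (\<kappa> * (D \<omega>)\<^sup>2) = max 1 (enn2real (W \<omega>))" for \<omega>
    using \<kappa> by (simp add: D_def)
  have W1: "1 \<le> W \<omega>" for \<omega>
    using lower[of "\<lambda>_. 0" \<omega>] by simp
  show thesis
  proof
    show "D \<in> borel_measurable M" unfolding D_def by measurable
    show "0 \<le> D \<omega>" for \<omega> using \<kappa> by (simp add: D_def)
    have "AE \<omega> in M. W \<omega> \<noteq> \<infinity>"
      using upper by (intro nn_integral_PInf_AE) (auto simp: top_unique)
    then show "AE \<omega> in M. \<forall>x y. (\<Sum>i\<in>I. \<Sum>j\<in>J. x i * y j * g i j \<omega>)
      \<le> D \<omega> * sqrt (\<Sum>i\<in>I. (x i)\<^sup>2) * sqrt (\<Sum>j\<in>J. (y j)\<^sup>2)"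
    proof (eventually_elim, intro allI)
      fix \<omega> :: 'w and x :: "'i \<Rightarrow> real" and y :: "'j \<Rightarrow> real"
      assume fin: "W \<omega> \<noteq> \<infinity>"
      define n where "n = sqrt (\<Sum>i\<in>I. (x i)\<^sup>2)"
      define h where "h j = (\<Sum>i\<in>I. x i * g i j \<omega>)" for j
      have n: "n \<ge> 0" "n\<^sup>2 = (\<Sum>i\<in>I. (x i)\<^sup>2)"
        by (auto simp: n_def sum_nonneg)
      have "sqrt (\<Sum>j\<in>J. (h j)\<^sup>2) \<le> D \<omega> * n"
      proof (cases "n = 0")
        case True
        then have "x i = 0" if "i \<in> I" for i
          using n(2) assms(2) that by (simp add: sum_nonneg_eq_0_iff)
        then show ?thesis using True by (simp add: h_def)
      next
        case False
        define a where "a i = x i / n" for i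
        have a: "a \<in> coord_ball I"
          using False n by (simp add: a_def power_divide sum_divide_distrib [symmetric])
        have h: "(\<Sum>j\<in>J. (\<Sum>i\<in>I. a i * g i j \<omega>)\<^sup>2) = (\<Sum>j\<in>J. (h j)\<^sup>2) / n\<^sup>2"
          by (simp add: a_def h_def sum_divide_distrib power_divide [symmetric])
        have "ennreal (exp (\<kappa> * ((\<Sum>j\<in>J. (h j)\<^sup>2) / n\<^sup>2))) \<le> W \<omega>"
          using lower[OF a, of \<omega>] unfolding h by (simp add: \<kappa>_def mult.commute)
        also have "W \<omega> = ennreal (enn2real (W \<omega>))"
          using fin by (simp add: top.not_eq_extremum)
        finally have "exp (\<kappa> * ((\<Sum>j\<in>J. (h j)\<^sup>2) / n\<^sup>2)) \<le> exp (\<kappa> * (D \<omega>)\<^sup>2)"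
          unfolding expD by simp
        then have "(\<Sum>j\<in>J. (h j)\<^sup>2) \<le> (D \<omega> * n)\<^sup>2"
          using \<kappa> False by (simp add: field_simps power_mult_distrib)
        then have "sqrt (\<Sum>j\<in>J. (h j)\<^sup>2) \<le> \<bar>D \<omega> * n\<bar>"
          using real_sqrt_le_mono by fastforce
        then show ?thesis
          using n \<kappa> by (simp add: D_def)
      qed
      then have "sqrt (\<Sum>j\<in>J. (h j)\<^sup>2) * sqrt (\<Sum>j\<in>J. (y j)\<^sup>2) \<le> D \<omega> * n * sqrt (\<Sum>j\<in>J. (y j)\<^sup>2)"
        by (rule mult_right_mono) (simp add: sum_nonneg)
      moreover have "(\<Sum>i\<in>I. \<Sum>j\<in>J. x i * y j * g i j \<omega>) \<le> sqrt (\<Sum>j\<in>J. (h j)\<^sup>2) * sqrt (\<Sum>j\<in>J. (y j)\<^sup>2)"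
      proof -
        have "(\<Sum>i\<in>I. \<Sum>j\<in>J. x i * y j * g i j \<omega>) = (\<Sum>j\<in>J. h j * y j)"
          by (subst sum.swap) (simp add: h_def sum_distrib_right sum_distrib_left mult_ac)
        also have "\<dots> \<le> (\<Sum>j\<in>J. \<bar>h j\<bar> * \<bar>y j\<bar>)"
          by (intro sum_mono) (simp add: abs_mult [symmetric])
        also have "\<dots> \<le> L2_set h J * L2_set y J" by (rule L2_set_mult_ineq)
        finally show ?thesis by (simp add: L2_set_def)
      qed
      ultimately show "(\<Sum>i\<in>I. \<Sum>j\<in>J. x i * y j * g i j \<omega>)
          \<le> D \<omega> * sqrt (\<Sum>i\<in>I. (x i)\<^sup>2) * sqrt (\<Sum>j\<in>J. (y j)\<^sup>2)"
        by (simp add: n_def)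
    qed
    have "(\<integral>\<^sup>+\<omega>. ennreal (exp (\<theta> * c\<^sup>2 * (D \<omega>)\<^sup>2 / 2)) \<partial>M) \<le> (\<integral>\<^sup>+\<omega>. W \<omega> \<partial>M)"
    proof (rule nn_integral_mono)
      fix \<omega>
      have "exp (\<theta> * c\<^sup>2 * (D \<omega>)\<^sup>2 / 2) = max 1 (enn2real (W \<omega>))"
        using expD[of \<omega>] by (simp add: \<kappa>_def)
      moreover have "ennreal (max 1 (enn2real (W \<omega>))) \<le> W \<omega>"
        using W1[of \<omega>] by (cases "W \<omega>") (auto simp: max_def)
      ultimately show "ennreal (exp (\<theta> * c\<^sup>2 * (D \<omega>)\<^sup>2 / 2)) \<le> W \<omega>" by simp
    qed
    with upper show "(\<integral>\<^sup>+\<omega>. ennreal (exp (\<theta> * c\<^sup>2 * (D \<omega>)\<^sup>2 / 2)) \<partial>M)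
      \<le> ennreal ((1 - \<theta>) powr (- real (card J) / 2) / (1 - c) ^ card I)" by simp
  qed
qed

lemma gaussian_matrix_mgf:
  fixes E :: "'w \<Rightarrow> real^'n^'m"
  assumes "prob_space M" "\<sigma> > 0"
    and dist: "\<And>i j. distributed M lborel (\<lambda>\<omega>. E \<omega> $ i $ j) (normal_density 0 \<sigma>)"
    and indep: "prob_space.indep_vars M (\<lambda>_. borel) (\<lambda>(i, j) \<omega>. E \<omega> $ i $ j) UNIV"
  shows "(\<integral>\<^sup>+\<omega>. ennreal (exp (B \<bullet> E \<omega>)) \<partial>M) = ennreal (exp (\<sigma>\<^sup>2 * (norm B)\<^sup>2 / 2))"
proof -
  interpret prob_space M by fact
  define X where "X p \<omega> = ennreal (exp (B $ fst p $ snd p * E \<omega> $ fst p $ snd p))" for p \<omega>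
  have "indep_vars (\<lambda>_. borel) X UNIV"
    using indep_vars_compose2[OF indep, of "\<lambda>p t. ennreal (exp (B $ fst p $ snd p * t))" "\<lambda>_. borel"]
    by (simp add: X_def [abs_def] case_prod_unfold)
  then have "(\<integral>\<^sup>+\<omega>. (\<Prod>p\<in>UNIV. X p \<omega>) \<partial>M) = (\<Prod>p\<in>UNIV. \<integral>\<^sup>+\<omega>. X p \<omega> \<partial>M)"
    by (intro indep_vars_nn_integral) auto
  also have "\<dots> = (\<Prod>p\<in>UNIV. ennreal (exp (\<sigma>\<^sup>2 * (B $ fst p $ snd p)\<^sup>2 / 2)))"
  proof (rule prod.cong)
    fix p :: "'m \<times> 'n"
    have "(\<integral>\<^sup>+\<omega>. X p \<omega> \<partial>M)
        = (\<integral>\<^sup>+t. ennreal (normal_density 0 \<sigma> t) * ennreal (exp (B $ fst p $ snd p * t)) \<partial>lborel)"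
      unfolding X_def by (subst distributed_nn_integral[OF dist]) auto
    then show "(\<integral>\<^sup>+\<omega>. X p \<omega> \<partial>M) = ennreal (exp (\<sigma>\<^sup>2 * (B $ fst p $ snd p)\<^sup>2 / 2))"
      by (simp add: nn_integral_exp_normal_density assms)
  qed simp
  also have "\<dots> = ennreal (exp (\<sigma>\<^sup>2 * (norm B)\<^sup>2 / 2))"
  proof -
    have "(norm B)\<^sup>2 = (\<Sum>p\<in>UNIV. (B $ fst p $ snd p)\<^sup>2)"
      unfolding power2_norm_eq_inner
      by (simp add: inner_vec_def power2_eq_square sum.cartesian_product case_prod_unfold)
    then show ?thesis
      by (simp add: prod_ennreal exp_sum sum_distrib_left sum_divide_distrib)
  qed
  also have "(\<lambda>\<omega>. \<Prod>p\<in>UNIV. X p \<omega>) = (\<lambda>\<omega>. ennreal (exp (B \<bullet> E \<omega>)))"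
    by (simp add: X_def prod_ennreal exp_sum [symmetric] inner_vec_def sum.cartesian_product
        case_prod_unfold)
  finally show ?thesis .
qed

text \<open>
  In coordinates with respect to an orthonormal basis of \<open>S\<close>, the matrix restricted to \<open>S\<close> is a
  Gaussian bilinear form in dimensions \<open>dim S\<close> and \<open>CARD('n)\<close>; the moment generating function on
  matrices of rank one, which depends on their norm only, identifies it as such. The
  roles of the two sides may be exchanged, so the expensive factor \<open>(1 - c)\<close> is charged to the
  smaller of the two dimensions. This matters: charged to the larger one, it would exceed the
  gain in the exponent when the dimensions are very different.
\<close>

lemma gaussian_matrix_noise_level:
  fixes E :: "'w \<Rightarrow> real^'n^'m" and S :: "(real^'m) set"
  assumes "prob_space M" "\<sigma> > 0"
    and dist: "\<And>i j. distributed M lborel (\<lambda>\<omega>. E \<omega> $ i $ j) (normal_density 0 \<sigma>)"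
    and indep: "prob_space.indep_vars M (\<lambda>_. borel) (\<lambda>(i, j) \<omega>. E \<omega> $ i $ j) UNIV"
    and "subspace S" "0 < \<theta>" "\<theta> < 1" "0 < c" "c < 1"
  obtains D where "D \<in> borel_measurable M" "\<And>\<omega>. 0 \<le> D \<omega>"
    and "AE \<omega> in M. \<forall>u\<in>S. \<forall>v. u \<bullet> (E \<omega> *v v) \<le> D \<omega> * norm u * norm v"
    and "(\<integral>\<^sup>+\<omega>. ennreal (exp (\<theta> * c\<^sup>2 * (D \<omega>)\<^sup>2 / (2 * \<sigma>\<^sup>2))) \<partial>M)
      \<le> ennreal ((1 - \<theta>) powr (- real (max (dim S) CARD('n)) / 2) / (1 - c) ^ (min (dim S) CARD('n)))"
proof -
  interpret prob_space M by fact
  obtain B where B: "B \<subseteq> S" "pairwise orthogonal B" "\<And>b. b \<in> B \<Longrightarrow> norm b = 1"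
    "independent B" "card B = dim S" "span B = S"
    using orthonormal_basis_subspace[OF \<open>subspace S\<close>] by metis
  have fB: "finite B" using B(4) by (rule independent_imp_finite)
  define g where "g b j \<omega> = (b \<bullet> (E \<omega> *v axis j 1)) / \<sigma>" for b j \<omega>
  have Em [measurable]: "(\<lambda>\<omega>. E \<omega> $ i $ j) \<in> borel_measurable M" for i j
    using distributed_measurable[OF dist[of i j]] by simp
  have gm: "g b j \<in> borel_measurable M" for b j
    unfolding g_def by (simp add: inner_vec_def matrix_vector_mult_basis column_def)
  have bil: "(\<Sum>b\<in>B. \<Sum>j\<in>UNIV. x b * v $ j * g b j \<omega>) = ((\<Sum>b\<in>B. x b *\<^sub>R b) \<bullet> (E \<omega> *v v)) / \<sigma>" for x v \<omega>
  proof -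
    have "E \<omega> *v v = (\<Sum>j\<in>UNIV. v $ j *\<^sub>R (E \<omega> *v axis j 1))"
      using matrix_mult_sum[of "E \<omega>" v] by (simp add: matrix_vector_mult_basis scalar_mult_eq_scaleR)
    then have "(\<Sum>b\<in>B. x b *\<^sub>R b) \<bullet> (E \<omega> *v v)
        = (\<Sum>b\<in>B. \<Sum>j\<in>UNIV. x b * (v $ j * (b \<bullet> (E \<omega> *v axis j 1))))"
      by (subst sum.swap) (simp only: inner_sum_left inner_scaleR_left inner_sum_right
          inner_scaleR_right sum_distrib_left mult.left_commute)
    then show ?thesis
      by (simp add: g_def sum_divide_distrib mult_ac)
  qed
  have norm_u: "(norm (\<Sum>b\<in>B. x b *\<^sub>R b))\<^sup>2 = (\<Sum>b\<in>B. (x b)\<^sup>2)" for x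
  proof -
    have "(norm (\<Sum>b\<in>B. x b *\<^sub>R b))\<^sup>2 = (\<Sum>b\<in>B. (norm (x b *\<^sub>R b))\<^sup>2)"
      using B(2) fB by (intro norm_sum_Pythagorean) (auto simp: pairwise_def orthogonal_clauses)
    then show ?thesis using B(3) by simp
  qed
  have norm_v: "(norm v)\<^sup>2 = (\<Sum>j\<in>UNIV. (v $ j)\<^sup>2)" for v :: "real^'n"
    unfolding power2_norm_eq_inner by (simp add: inner_vec_def power2_eq_square)
  have mgf: "(\<integral>\<^sup>+\<omega>. ennreal (exp (\<Sum>b\<in>B. \<Sum>j\<in>UNIV. x b * y j * g b j \<omega>)) \<partial>M)
      = ennreal (exp ((\<Sum>b\<in>B. (x b)\<^sup>2) * (\<Sum>j\<in>UNIV. (y j)\<^sup>2) / 2))" for x and y :: "'n \<Rightarrow> real"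
  proof -
    define u where "u = (\<Sum>b\<in>B. x b *\<^sub>R b)"
    define v :: "real^'n" where "v = (\<chi> j. y j)"
    define C :: "real^'n^'m" where "C = (\<chi> i j. u $ i * v $ j / \<sigma>)"
    have "(norm C)\<^sup>2 = (norm u)\<^sup>2 * (norm v)\<^sup>2 / \<sigma>\<^sup>2"
      unfolding power2_norm_eq_inner
      by (simp add: C_def inner_vec_def sum_product sum_divide_distrib power2_eq_square mult_ac)
    moreover have "C \<bullet> E \<omega> = (\<Sum>b\<in>B. \<Sum>j\<in>UNIV. x b * y j * g b j \<omega>)" for \<omega>
    proof -
      have "C \<bullet> E \<omega> = (u \<bullet> (E \<omega> *v v)) / \<sigma>"
        by (simp add: C_def inner_vec_def matrix_vector_mult_def sum_distrib_left sum_divide_distrib mult_ac)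
      also have "\<dots> = (\<Sum>b\<in>B. \<Sum>j\<in>UNIV. x b * y j * g b j \<omega>)"
        using bil[of x v \<omega>] by (simp add: u_def v_def)
      finally show ?thesis .
    qed
    ultimately show ?thesis
      using gaussian_matrix_mgf[OF assms(1,2) dist indep, of C] \<open>\<sigma> > 0\<close> norm_u[of x] norm_v[of v]
      by (simp add: u_def v_def)
  qed
  have "\<exists>D. D \<in> borel_measurable M \<and> (\<forall>\<omega>. 0 \<le> D \<omega>) \<and>
      (AE \<omega> in M. \<forall>x y. (\<Sum>b\<in>B. \<Sum>j\<in>UNIV. x b * y j * g b j \<omega>)
        \<le> D \<omega> * sqrt (\<Sum>b\<in>B. (x b)\<^sup>2) * sqrt (\<Sum>j\<in>UNIV. (y j)\<^sup>2)) \<and>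
      (\<integral>\<^sup>+\<omega>. ennreal (exp (\<theta> * c\<^sup>2 * (D \<omega>)\<^sup>2 / 2)) \<partial>M)
        \<le> ennreal ((1 - \<theta>) powr (- real (max (dim S) CARD('n)) / 2) / (1 - c) ^ (min (dim S) CARD('n)))"
  proof (cases "dim S \<le> CARD('n)")
    case True
    show ?thesis
      by (rule gaussian_bilinear_norm[OF sigma_finite_measure_axioms fB finite assms(6-9) gm mgf])
        (use True in \<open>auto simp: max_def min_def B(5)\<close>)
  next
    case False
    have mgf': "(\<integral>\<^sup>+\<omega>. ennreal (exp (\<Sum>j\<in>UNIV. \<Sum>b\<in>B. y j * x b * g b j \<omega>)) \<partial>M)
      = ennreal (exp ((\<Sum>j\<in>UNIV. (y j)\<^sup>2) * (\<Sum>b\<in>B. (x b)\<^sup>2) / 2))" for x and y :: "'n \<Rightarrow> real"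
      using mgf[of x y] by (subst sum.swap) (simp add: mult_ac)
    obtain D where D: "D \<in> borel_measurable M" "\<And>\<omega>. 0 \<le> D \<omega>"
      and bound: "AE \<omega> in M. \<forall>y x. (\<Sum>j\<in>UNIV. \<Sum>b\<in>B. y j * x b * g b j \<omega>)
        \<le> D \<omega> * sqrt (\<Sum>j\<in>UNIV. (y j)\<^sup>2) * sqrt (\<Sum>b\<in>B. (x b)\<^sup>2)"
      and mom: "(\<integral>\<^sup>+\<omega>. ennreal (exp (\<theta> * c\<^sup>2 * (D \<omega>)\<^sup>2 / 2)) \<partial>M)
        \<le> ennreal ((1 - \<theta>) powr (- real (card B) / 2) / (1 - c) ^ CARD('n))"
      by (rule gaussian_bilinear_norm[OF sigma_finite_measure_axioms finite fB assms(6-9), where g = "\<lambda>j b. g b j", OF gm mgf'])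
        blast
    from bound have "AE \<omega> in M. \<forall>x y. (\<Sum>b\<in>B. \<Sum>j\<in>UNIV. x b * y j * g b j \<omega>)
        \<le> D \<omega> * sqrt (\<Sum>b\<in>B. (x b)\<^sup>2) * sqrt (\<Sum>j\<in>UNIV. (y j)\<^sup>2)"
    proof (eventually_elim, intro allI)
      fix \<omega> and x :: "real^'m \<Rightarrow> real" and y :: "'n \<Rightarrow> real"
      assume "\<forall>y x. (\<Sum>j\<in>UNIV. \<Sum>b\<in>B. y j * x b * g b j \<omega>)
        \<le> D \<omega> * sqrt (\<Sum>j\<in>UNIV. (y j)\<^sup>2) * sqrt (\<Sum>b\<in>B. (x b)\<^sup>2)"
      then have "(\<Sum>j\<in>UNIV. \<Sum>b\<in>B. y j * x b * g b j \<omega>)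
        \<le> D \<omega> * sqrt (\<Sum>j\<in>UNIV. (y j)\<^sup>2) * sqrt (\<Sum>b\<in>B. (x b)\<^sup>2)" by blast
      then show "(\<Sum>b\<in>B. \<Sum>j\<in>UNIV. x b * y j * g b j \<omega>)
        \<le> D \<omega> * sqrt (\<Sum>b\<in>B. (x b)\<^sup>2) * sqrt (\<Sum>j\<in>UNIV. (y j)\<^sup>2)"
        by (subst sum.swap) (simp add: mult_ac)
    qed
    with D mom False show ?thesis
      by (intro exI[of _ D]) (simp add: max_def min_def B(5))
  qed
  then obtain D where D [measurable]: "D \<in> borel_measurable M" and D0: "\<And>\<omega>. 0 \<le> D \<omega>"
    and bound: "AE \<omega> in M. \<forall>x y. (\<Sum>b\<in>B. \<Sum>j\<in>UNIV. x b * y j * g b j \<omega>)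
        \<le> D \<omega> * sqrt (\<Sum>b\<in>B. (x b)\<^sup>2) * sqrt (\<Sum>j\<in>UNIV. (y j)\<^sup>2)"
    and mom: "(\<integral>\<^sup>+\<omega>. ennreal (exp (\<theta> * c\<^sup>2 * (D \<omega>)\<^sup>2 / 2)) \<partial>M)
        \<le> ennreal ((1 - \<theta>) powr (- real (max (dim S) CARD('n)) / 2) / (1 - c) ^ (min (dim S) CARD('n)))"
    by blast
  show thesis
  proof
    show "(\<lambda>\<omega>. \<sigma> * D \<omega>) \<in> borel_measurable M" by measurable
    show "0 \<le> \<sigma> * D \<omega>" for \<omega> using D0 \<open>\<sigma> > 0\<close> by simp
    show "AE \<omega> in M. \<forall>u\<in>S. \<forall>v. u \<bullet> (E \<omega> *v v) \<le> \<sigma> * D \<omega> * norm u * norm v"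
      using bound
    proof (eventually_elim, intro ballI allI)
      fix \<omega> u v
      assume b: "\<forall>x y. (\<Sum>b\<in>B. \<Sum>j\<in>UNIV. x b * y j * g b j \<omega>)
        \<le> D \<omega> * sqrt (\<Sum>b\<in>B. (x b)\<^sup>2) * sqrt (\<Sum>j\<in>UNIV. (y j)\<^sup>2)" and "u \<in> S"
      have u: "(\<Sum>b\<in>B. (u \<bullet> b) *\<^sub>R b) = u"
        using B fB \<open>u \<in> S\<close> by (intro orthonormal_basis_expand) auto
      have "(u \<bullet> (E \<omega> *v v)) / \<sigma> \<le> D \<omega> * sqrt ((norm u)\<^sup>2) * sqrt ((norm v)\<^sup>2)"
        using b[rule_format, of "\<lambda>b. u \<bullet> b" "\<lambda>j. v $ j"] bil[of "\<lambda>b. u \<bullet> b" v \<omega>] norm_u[of "\<lambda>b. u \<bullet> b"]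
        by (simp only: u norm_v [symmetric])
      then show "u \<bullet> (E \<omega> *v v) \<le> \<sigma> * D \<omega> * norm u * norm v"
        using \<open>\<sigma> > 0\<close> by (simp add: field_simps)
    qed
    show "(\<integral>\<^sup>+\<omega>. ennreal (exp (\<theta> * c\<^sup>2 * (\<sigma> * D \<omega>)\<^sup>2 / (2 * \<sigma>\<^sup>2))) \<partial>M)
      \<le> ennreal ((1 - \<theta>) powr (- real (max (dim S) CARD('n)) / 2) / (1 - c) ^ (min (dim S) CARD('n)))"
      using mom \<open>\<sigma> > 0\<close> by (simp add: power_mult_distrib mult.assoc)
  qed
qed

section \<open>Tail and mean excess of the noise level\<close>

text \<open>
  For \<open>\<theta> = 3/4\<close> and \<open>c = 9/10\<close> the moment bound of the noise level is \<open>2 ^ q * 10 ^ p\<close>, with \<open>p\<close> the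
  smaller and \<open>q\<close> the larger dimension. Both inequalities follow from
  \<open>q + 3 p \<le> (sqrt p + sqrt q)\<^sup>2\<close>; the coefficient of \<open>q\<close> is the tight one, as \<open>ln 2 + 1/2\<close> has to
  stay below \<open>243/200 = 2 \<theta> c\<^sup>2\<close>.
\<close>

lemma exponent_bounds:
  fixes p q :: nat
  assumes "p \<le> q"
  shows "q * ln 2 + p * ln 10 - 243 / 200 * (sqrt p + sqrt q)\<^sup>2 \<le> - (q + p) / 2"
    and "q * ln 2 + p * ln 10 - 243 / 250 * (sqrt p + sqrt q)\<^sup>2 \<le> - q / 4"
proof -
  have "real p * real p \<le> real p * real q" using assms by (intro mult_left_mono) auto
  then have "real p \<le> sqrt (real p * real q)" by (intro real_le_rsqrt) (simp add: power2_eq_square)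
  then have s: "real q + 3 * real p \<le> (sqrt p + sqrt q)\<^sup>2"
    by (simp add: power2_sum real_sqrt_mult)
  have ln2: "ln 2 \<le> (25 / 36 :: real)" by (rule ln2_le_25_over_36)
  have "ln 10 \<le> ln (16 :: real)" by simp
  also have "\<dots> = 4 * ln 2" using ln_realpow[of 2 4] by simp
  finally have ln10: "ln 10 \<le> (100 / 36 :: real)" using ln2 by simp
  have l: "q * ln 2 + p * ln 10 \<le> q * (25 / 36) + p * (100 / 36)"
    using ln2 ln10 by (intro add_mono mult_left_mono) auto
  show "q * ln 2 + p * ln 10 - 243 / 200 * (sqrt p + sqrt q)\<^sup>2 \<le> - (q + p) / 2"
    using l s by (simp add: field_simps)
  show "q * ln 2 + p * ln 10 - 243 / 250 * (sqrt p + sqrt q)\<^sup>2 \<le> - q / 4"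
    using l s by (simp add: field_simps)
qed

text \<open>
  The threshold \<open>2 \<sigma> s\<close> is the square root of \<open>4 \<sigma>\<^sup>2 s\<^sup>2\<close>, while the excess is measured over the
  smaller value \<open>16/5 \<sigma>\<^sup>2 s\<^sup>2\<close>, four fifths of it. Both estimates are exponential Markov
  inequalities.
\<close>

lemma gaussian_noise_bounds:
  fixes E :: "'w \<Rightarrow> real^'n^'m" and S :: "(real^'m) set"
  assumes "prob_space M" "\<sigma> > 0"
    and dist: "\<And>i j. distributed M lborel (\<lambda>\<omega>. E \<omega> $ i $ j) (normal_density 0 \<sigma>)"
    and indep: "prob_space.indep_vars M (\<lambda>_. borel) (\<lambda>(i, j) \<omega>. E \<omega> $ i $ j) UNIV"
    and "subspace S" and n: "12 \<le> CARD('n)"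
  defines "s \<equiv> sqrt (real (dim S)) + sqrt (real CARD('n))"
  obtains D where "D \<in> borel_measurable M" "\<And>\<omega>. 0 \<le> D \<omega>"
    and "AE \<omega> in M. \<forall>u\<in>S. \<forall>v. u \<bullet> (E \<omega> *v v) \<le> D \<omega> * norm u * norm v"
    and "measure M {\<omega> \<in> space M. 2 * \<sigma> * s < D \<omega>} \<le> exp (- (real CARD('n) + real (dim S)) / 2)"
    and "integrable M (\<lambda>\<omega>. max 0 ((D \<omega>)\<^sup>2 - 16 / 5 * \<sigma>\<^sup>2 * s\<^sup>2))"
    and "(\<integral>\<omega>. max 0 ((D \<omega>)\<^sup>2 - 16 / 5 * \<sigma>\<^sup>2 * s\<^sup>2) \<partial>M) \<le> \<sigma>\<^sup>2 / 2"
proof -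
  interpret prob_space M by fact
  define p where "p = min (dim S) CARD('n)"
  define q where "q = max (dim S) CARD('n)"
  \<comment> \<open>\<open>\<kappa> = \<theta> c\<^sup>2 / (2 \<sigma>\<^sup>2)\<close> for \<open>\<theta> = 3/4\<close> and \<open>c = 9/10\<close>\<close>
  define \<kappa> where "\<kappa> = 243 / (800 * \<sigma>\<^sup>2)"
  have \<kappa>: "\<kappa> > 0" using \<open>\<sigma> > 0\<close> by (simp add: \<kappa>_def)
  have pq: "p \<le> q" "12 \<le> q" "real q + real p = real CARD('n) + real (dim S)" "s = sqrt p + sqrt q"
    using n by (auto simp: p_def q_def s_def min_def max_def)
  obtain D where D [measurable]: "D \<in> borel_measurable M" and D0: "\<And>\<omega>. 0 \<le> D \<omega>"
    and bound: "AE \<omega> in M. \<forall>u\<in>S. \<forall>v. u \<bullet> (E \<omega> *v v) \<le> D \<omega> * norm u * norm v"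
    and mom: "(\<integral>\<^sup>+\<omega>. ennreal (exp (3/4 * (9/10)\<^sup>2 * (D \<omega>)\<^sup>2 / (2 * \<sigma>\<^sup>2))) \<partial>M)
      \<le> ennreal ((1 - 3/4) powr (- real q / 2) / (1 - 9/10) ^ p)"
    unfolding p_def q_def
    by (rule gaussian_matrix_noise_level[OF assms(1,2) dist indep \<open>subspace S\<close>, of "3/4" "9/10"]) auto
  have const: "(1 - 3/4) powr (- real q / 2) / (1 - 9/10) ^ p = exp (q * ln 2 + p * ln 10)"
  proof -
    have "ln (4 :: real) = 2 * ln 2" using ln_realpow[of 2 2] by simp
    then have q_part: "(1 - 3/4 :: real) powr (- real q / 2) = exp (q * ln 2)"
      by (simp add: powr_def ln_div)
    have p_part: "1 / (1 - 9/10 :: real) ^ p = exp (p * ln 10)"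
      by (simp add: power_divide exp_of_nat_mult)
    have "x / y = x * (1 / y)" for x y :: real by simp
    then show ?thesis unfolding exp_add q_part [symmetric] p_part [symmetric] .
  qed
  have expo: "3/4 * (9/10)\<^sup>2 * d\<^sup>2 / (2 * \<sigma>\<^sup>2) = \<kappa> * d\<^sup>2" for d
    by (simp add: \<kappa>_def power2_eq_square)
  have mom': "(\<integral>\<^sup>+\<omega>. ennreal (exp (\<kappa> * (D \<omega>)\<^sup>2)) \<partial>M) \<le> ennreal (exp (q * ln 2 + p * ln 10))"
    using mom unfolding expo const .
  have shifted: "(\<integral>\<^sup>+\<omega>. ennreal (exp (\<kappa> * ((D \<omega>)\<^sup>2 - x))) \<partial>M) \<le> ennreal (exp (q * ln 2 + p * ln 10 - \<kappa> * x))" for x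
  proof -
    have "(\<integral>\<^sup>+\<omega>. ennreal (exp (\<kappa> * ((D \<omega>)\<^sup>2 - x))) \<partial>M)
        = (\<integral>\<^sup>+\<omega>. ennreal (exp (- \<kappa> * x)) * ennreal (exp (\<kappa> * (D \<omega>)\<^sup>2)) \<partial>M)"
      by (intro nn_integral_cong) (simp add: ennreal_mult' [symmetric] exp_add [symmetric] algebra_simps)
    also have "\<dots> = ennreal (exp (- \<kappa> * x)) * (\<integral>\<^sup>+\<omega>. ennreal (exp (\<kappa> * (D \<omega>)\<^sup>2)) \<partial>M)"
      by (rule nn_integral_cmult) measurable
    also have "\<dots> \<le> ennreal (exp (- \<kappa> * x)) * ennreal (exp (q * ln 2 + p * ln 10))"
      by (rule mult_left_mono[OF mom']) simp
    also have "\<dots> = ennreal (exp (q * ln 2 + p * ln 10 - \<kappa> * x))"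
      by (simp add: ennreal_mult' [symmetric] exp_add [symmetric])
    finally show ?thesis .
  qed
  have s0: "0 \<le> s" by (simp add: s_def)
  show thesis
  proof (rule that[OF D D0 bound])
    let ?x = "4 * \<sigma>\<^sup>2 * s\<^sup>2"
    have "emeasure M {\<omega> \<in> space M. 2 * \<sigma> * s < D \<omega>} = (\<integral>\<^sup>+\<omega>. indicator {\<omega> \<in> space M. 2 * \<sigma> * s < D \<omega>} \<omega> \<partial>M)"
      by (rule nn_integral_indicator [symmetric]) measurable
    also have "\<dots> \<le> (\<integral>\<^sup>+\<omega>. ennreal (exp (\<kappa> * ((D \<omega>)\<^sup>2 - ?x))) \<partial>M)"
    proof (intro nn_integral_mono)
      fix \<omega>
      have "1 \<le> exp (\<kappa> * ((D \<omega>)\<^sup>2 - ?x))" if "2 * \<sigma> * s < D \<omega>"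
      proof -
        have "(2 * \<sigma> * s)\<^sup>2 \<le> (D \<omega>)\<^sup>2"
          using that s0 \<open>\<sigma> > 0\<close> by (intro power_mono) auto
        then show ?thesis using \<kappa> by (simp add: power_mult_distrib)
      qed
      then show "indicator {\<omega> \<in> space M. 2 * \<sigma> * s < D \<omega>} \<omega> \<le> ennreal (exp (\<kappa> * ((D \<omega>)\<^sup>2 - ?x)))"
        by (auto simp: indicator_def simp del: one_le_exp_iff)
    qed
    also have "\<dots> \<le> ennreal (exp (q * ln 2 + p * ln 10 - \<kappa> * ?x))" by (rule shifted)
    also have "\<dots> \<le> ennreal (exp (- (q + p) / 2))"
      using exponent_bounds(1)[OF pq(1)] \<open>\<sigma> > 0\<close>
      by (intro ennreal_leI) (simp add: \<kappa>_def pq(4))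
    finally show "measure M {\<omega> \<in> space M. 2 * \<sigma> * s < D \<omega>} \<le> exp (- (real CARD('n) + real (dim S)) / 2)"
      by (simp add: emeasure_eq_measure pq(3) [symmetric])
  next
    let ?x = "16 / 5 * \<sigma>\<^sup>2 * s\<^sup>2"
    let ?T = "\<lambda>\<omega>. max 0 ((D \<omega>)\<^sup>2 - ?x)"
    have "(\<integral>\<^sup>+\<omega>. ennreal (?T \<omega>) \<partial>M) \<le> (\<integral>\<^sup>+\<omega>. ennreal (1 / \<kappa>) * ennreal (exp (\<kappa> * ((D \<omega>)\<^sup>2 - ?x))) \<partial>M)"
    proof (rule nn_integral_mono)
      fix \<omega>
      have "\<kappa> * ((D \<omega>)\<^sup>2 - ?x) \<le> exp (\<kappa> * ((D \<omega>)\<^sup>2 - ?x))"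
        using exp_ge_add_one_self[of "\<kappa> * ((D \<omega>)\<^sup>2 - ?x)"] by linarith
      then have "(D \<omega>)\<^sup>2 - ?x \<le> exp (\<kappa> * ((D \<omega>)\<^sup>2 - ?x)) / \<kappa>"
        using \<kappa> by (simp add: pos_le_divide_eq mult.commute)
      then have "?T \<omega> \<le> 1 / \<kappa> * exp (\<kappa> * ((D \<omega>)\<^sup>2 - ?x))" using \<kappa> by simp
      then show "ennreal (?T \<omega>) \<le> ennreal (1 / \<kappa>) * ennreal (exp (\<kappa> * ((D \<omega>)\<^sup>2 - ?x)))"
        using \<kappa> by (simp only: ennreal_mult' [symmetric] ennreal_leI divide_nonneg_pos zero_le_one)
    qed
    also have "\<dots> = ennreal (1 / \<kappa>) * (\<integral>\<^sup>+\<omega>. ennreal (exp (\<kappa> * ((D \<omega>)\<^sup>2 - ?x))) \<partial>M)"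
      by (rule nn_integral_cmult) measurable
    also have "\<dots> \<le> ennreal (1 / \<kappa>) * ennreal (exp (q * ln 2 + p * ln 10 - \<kappa> * ?x))"
      by (rule mult_left_mono[OF shifted]) simp
    also have "\<dots> = ennreal (1 / \<kappa> * exp (q * ln 2 + p * ln 10 - \<kappa> * ?x))"
      by (rule ennreal_mult' [symmetric]) (use \<kappa> in simp)
    also have "\<dots> \<le> ennreal (\<sigma>\<^sup>2 / 2)"
    proof (rule ennreal_leI)
      have \<kappa>x: "\<kappa> * ?x = 243 / 250 * s\<^sup>2" using \<open>\<sigma> > 0\<close> by (simp add: \<kappa>_def)
      have "exp (q * ln 2 + p * ln 10 - \<kappa> * ?x) \<le> exp (- real q / 4)"
        using exponent_bounds(2)[OF pq(1), folded pq(4)] unfolding \<kappa>x by simp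
      also have "\<dots> \<le> exp (- 3)" using pq(2) by simp
      also have "\<dots> \<le> 1 / 8"
      proof -
        have "(2 :: real) ^ 3 \<le> exp 1 ^ 3" using exp_ge_add_one_self[of 1] by (intro power_mono) auto
        also have "\<dots> = exp 3" by (simp add: exp_of_nat_mult [symmetric])
        finally have "8 \<le> exp (3 :: real)" by simp
        then show ?thesis by (simp add: exp_minus field_simps)
      qed
      finally have "1 / \<kappa> * exp (q * ln 2 + p * ln 10 - \<kappa> * ?x) \<le> 1 / \<kappa> * (1 / 8)"
        using \<kappa> by (intro mult_left_mono) auto
      also have "\<dots> = 100 / 243 * \<sigma>\<^sup>2" by (simp add: \<kappa>_def)
      also have "\<dots> \<le> \<sigma>\<^sup>2 / 2" by simp
      finally show "1 / \<kappa> * exp (q * ln 2 + p * ln 10 - \<kappa> * ?x) \<le> \<sigma>\<^sup>2 / 2" .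
    qed
    finally have T: "(\<integral>\<^sup>+\<omega>. ennreal (?T \<omega>) \<partial>M) \<le> ennreal (\<sigma>\<^sup>2 / 2)" .
    show int: "integrable M ?T"
      by (rule integrableI_bounded) (use T in \<open>auto simp: le_less_trans ennreal_less_top\<close>)
    have "ennreal (\<integral>\<omega>. ?T \<omega> \<partial>M) = (\<integral>\<^sup>+\<omega>. ennreal (?T \<omega>) \<partial>M)"
      by (rule nn_integral_eq_integral [symmetric]) (use int in auto)
    with T have "ennreal (\<integral>\<omega>. ?T \<omega> \<partial>M) \<le> ennreal (\<sigma>\<^sup>2 / 2)" by simp
    then show "(\<integral>\<omega>. ?T \<omega> \<partial>M) \<le> \<sigma>\<^sup>2 / 2" by simp
  qed
qed

section \<open>Risk bounds for the rank penalized estimator\<close>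

lemma borel_measurable_norm_matrix_mult [measurable]:
  fixes V :: "real^'n^'m" and A0 :: "real^'k^'n"
  shows "(\<lambda>A. norm (V ** (A - A0))) \<in> borel_measurable borel"
proof -
  have "linear (\<lambda>A::real^'k^'n. V ** A)"
    by (rule linearI) (simp_all add: matrix_matrix_mult_def vec_eq_iff distrib_left
        sum.distrib sum_distrib_left mult.left_commute)
  then have "continuous_on UNIV (\<lambda>A::real^'k^'n. V ** A)"
    by (simp add: linear_continuous_on linear_linear)
  then have "continuous_on UNIV (\<lambda>A. V ** (A - A0))"
    by (rule continuous_on_compose2) (auto intro!: continuous_intros)
  then show ?thesis
    by (intro borel_measurable_continuous_onI continuous_on_norm)
qed

theorem corollary11:
  fixes M :: "'w measure"
    and V :: "real^'m1^'l"
    and A0 :: "real^'m2^'m1"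
    and E U :: "'w \<Rightarrow> real^'m2^'l"
    and Ahat :: "'w \<Rightarrow> real^'m2^'m1"
    and \<sigma> \<rho> lambda :: real
    and r :: nat
  assumes "prob_space M"
    and "\<sigma> > 0"
    and "\<And>i j. distributed M lborel (\<lambda>\<omega>. E \<omega> $ i $ j) (normal_density 0 \<sigma>)"
    and "prob_space.indep_vars M (\<lambda>_. borel) (\<lambda>(i, j) \<omega>. E \<omega> $ i $ j) UNIV"
    and "\<And>\<omega>. \<omega> \<in> space M \<Longrightarrow> U \<omega> = V ** A0 + E \<omega>"
    and "ln (real CARD('m2)) \<ge> 4"
    and "\<rho> \<ge> 1"
    and "r = rank V"
    and "sqrt lambda = 4 * \<rho> * \<sigma> * (sqrt (real r) + sqrt (real CARD('m2)))"
    and "Ahat \<in> borel_measurable M"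
    and "\<And>\<omega>. \<omega> \<in> space M \<Longrightarrow>
      is_rank_penalized_estimator V (U \<omega>) (lambda / (real CARD('l) * real CARD('m2))) (Ahat \<omega>)"
  shows
    "measure M {\<omega> \<in> space M.
        norm (V ** (Ahat \<omega> - A0)) \<le>
          (INF A. norm (V ** (A - A0)) +
             2 * sqrt (lambda * max (real (rank A0) / \<rho>\<^sup>2) (real (rank A)))) \<and>
        norm (V ** (Ahat \<omega> - A0)) \<le>
          8 * \<rho> * \<sigma> * (sqrt (real r) + sqrt (real CARD('m2))) * sqrt (real (rank A0))}
      \<ge> 1 - exp (- (real CARD('m2) + real r) / 2) \<and>
    measure M {\<omega> \<in> space M.
        (norm (V ** (Ahat \<omega> - A0)))\<^sup>2 \<le>
          (INF A. (2 * \<rho>\<^sup>2 + 1) / (2 * \<rho>\<^sup>2 - 1) * (norm (V ** (A - A0)))\<^sup>2 +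
             4 * \<rho>\<^sup>2 * lambda / (2 * \<rho>\<^sup>2 - 1) * real (rank A))}
      \<ge> 1 - exp (- (real CARD('m2) + real r) / 2) \<and>
    integrable M (\<lambda>\<omega>. norm (V ** (Ahat \<omega> - A0))) \<and>
      (\<integral>\<omega>. norm (V ** (Ahat \<omega> - A0)) \<partial>M) \<le>
        (INF A. norm (V ** (A - A0)) +
           5 / 2 * sqrt (lambda * max (real (rank A)) (max (real (rank A0) / \<rho>\<^sup>2) (1 / (4 * \<rho>\<^sup>2))))) \<and>
      (\<integral>\<omega>. norm (V ** (Ahat \<omega> - A0)) \<partial>M) \<le>
        10 * \<rho> * \<sigma> * (sqrt (real r) + sqrt (real CARD('m2))) * sqrt (max (real (rank A0)) (1 / 4)) \<and>
    integrable M (\<lambda>\<omega>. (norm (V ** (Ahat \<omega> - A0)))\<^sup>2) \<and>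
      (\<integral>\<omega>. (norm (V ** (Ahat \<omega> - A0)))\<^sup>2 \<partial>M) \<le>
        (INF A. (2 * \<rho>\<^sup>2 + 1) / (2 * \<rho>\<^sup>2 - 1) * (norm (V ** (A - A0)))\<^sup>2 +
           4 * \<rho>\<^sup>2 * lambda / (2 * \<rho>\<^sup>2 - 1) * max (real (rank A)) (1 / 2)) \<and>
      (\<integral>\<omega>. (norm (V ** (Ahat \<omega> - A0)))\<^sup>2 \<partial>M) \<le>
        64 * \<rho>\<^sup>2 * \<sigma>\<^sup>2 * (sqrt (real r) + sqrt (real CARD('m2)))\<^sup>2 * max (real (rank A0)) (1 / 2)"
proof -
  interpret prob_space M by fact
  note [measurable] = assms(10)
  define m where "m = real CARD('m2)"
  define s where "s = sqrt (real r) + sqrt m"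
  define a where "a \<omega> = norm (V ** (Ahat \<omega> - A0))" for \<omega>
  define b where "b A = norm (V ** (A - A0))" for A :: "real^'m2^'m1"
  define k where "k \<omega> = real (rank (Ahat \<omega>))" for \<omega>
  define r0 where "r0 = real (rank A0)"
  have [measurable]: "a \<in> borel_measurable M" unfolding a_def by measurable
  have nonneg: "0 \<le> a \<omega>" "0 \<le> b A" "0 \<le> k \<omega>" "0 \<le> r0" for \<omega> A
    by (auto simp: a_def b_def k_def r0_def)
  have b0: "b A0 = 0" by (simp add: b_def)
  have rank_le: "real (rank A) \<le> m" for A :: "real^'m2^'m1"
    using rank_bound[of A] by (simp add: m_def)
  have m16: "16 \<le> m"
  proof -
    have "(2 :: real) ^ 4 \<le> exp 1 ^ 4" using exp_ge_add_one_self[of 1] by (intro power_mono) auto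
    also have "\<dots> = exp 4" by (simp add: exp_of_nat_mult [symmetric])
    also have "\<dots> \<le> exp (ln m)" using assms(6) unfolding m_def by (simp only: exp_le_cancel_iff)
    finally show ?thesis by (simp add: m_def)
  qed
  have s: "sqrt m \<le> s" "4 \<le> s" "m \<le> s\<^sup>2"
  proof -
    show 1: "sqrt m \<le> s" by (simp add: s_def)
    have "4 \<le> sqrt m" using m16 by (intro real_le_rsqrt) simp
    with 1 show "4 \<le> s" by simp
    have "(sqrt m)\<^sup>2 \<le> s\<^sup>2" using 1 m16 by (intro power_mono) auto
    then show "m \<le> s\<^sup>2" using m16 by simp
  qed
  have sqrt_lambda: "sqrt lambda = 4 * \<rho> * \<sigma> * s" using assms(9) by (simp add: s_def m_def)
  then have "0 < sqrt lambda" using assms s by simp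
  then have lambda_pos: "0 < lambda" by simp
  then have lambda: "lambda = 16 * \<rho>\<^sup>2 * \<sigma>\<^sup>2 * s\<^sup>2"
    using real_sqrt_pow2[of lambda] unfolding sqrt_lambda by (simp add: power_mult_distrib)
  have \<rho>: "1 \<le> \<rho>" "1 \<le> \<rho>\<^sup>2" "0 < 2 * \<rho>\<^sup>2 - 1"
  proof -
    show 1: "1 \<le> \<rho>" by fact
    show 2: "1 \<le> \<rho>\<^sup>2" using power_mono[OF 1, of 2] by simp
    show "0 < 2 * \<rho>\<^sup>2 - 1" using 2 by linarith
  qed
  have r0_div: "r0 / \<rho>\<^sup>2 \<le> r0"
    using divide_left_mono[OF \<rho>(2) nonneg(4)] \<rho> by simp
  have "subspace (range ((*v) V))"
    by (rule linear_subspace_image) auto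
  moreover have dimS: "dim (range ((*v) V)) = r"
    using assms(8) by (simp add: rank_dim_range)
  moreover have "12 \<le> CARD('m2)"
    using m16 unfolding m_def by linarith
  ultimately obtain D where D [measurable]: "D \<in> borel_measurable M" and D0: "\<And>\<omega>. 0 \<le> D \<omega>"
    and bound: "AE \<omega> in M. \<forall>u\<in>range ((*v) V). \<forall>v. u \<bullet> (E \<omega> *v v) \<le> D \<omega> * norm u * norm v"
    and tail: "measure M {\<omega> \<in> space M. 2 * \<sigma> * s < D \<omega>} \<le> exp (- (m + real r) / 2)"
    and int_T: "integrable M (\<lambda>\<omega>. max 0 ((D \<omega>)\<^sup>2 - 16 / 5 * \<sigma>\<^sup>2 * s\<^sup>2))"
    and exp_T: "(\<integral>\<omega>. max 0 ((D \<omega>)\<^sup>2 - 16 / 5 * \<sigma>\<^sup>2 * s\<^sup>2) \<partial>M) \<le> \<sigma>\<^sup>2 / 2"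
    unfolding s_def m_def
    using gaussian_noise_bounds[OF assms(1-4), of "range ((*v) V)" thesis] by simp
  define T where "T \<omega> = max 0 ((D \<omega>)\<^sup>2 - 16 / 5 * \<sigma>\<^sup>2 * s\<^sup>2)" for \<omega>
  note int_T = int_T[folded T_def] and exp_T = exp_T[folded T_def]
  have T0: "0 \<le> T \<omega>" for \<omega> by (simp add: T_def)

  have basic: "AE \<omega> in M. \<forall>A. (a \<omega>)\<^sup>2 \<le> (b A)\<^sup>2
      + 2 * D \<omega> * sqrt (k \<omega> + real (rank A)) * (a \<omega> + b A) + lambda * (real (rank A) - k \<omega>)"
    using bound AE_space
  proof (eventually_elim, intro allI)
    fix \<omega> and A :: "real^'m2^'m1"
    assume *: "\<forall>u\<in>range ((*v) V). \<forall>v. u \<bullet> (E \<omega> *v v) \<le> D \<omega> * norm u * norm v" and "\<omega> \<in> space M"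
    then have "is_arg_min (\<lambda>B. (norm (V ** A0 + E \<omega> - V ** B))\<^sup>2 + lambda * real (rank B)) (\<lambda>_. True) (Ahat \<omega>)"
      using assms(11)[of \<omega>] assms(5)[of \<omega>] by (simp add: is_rank_penalized_estimator_iff)
    then have "(norm (V ** A0 + E \<omega> - V ** Ahat \<omega>))\<^sup>2 + lambda * real (rank (Ahat \<omega>))
        \<le> (norm (V ** A0 + E \<omega> - V ** A))\<^sup>2 + lambda * real (rank A)"
      by (simp add: is_arg_min_def not_less)
    from rank_penalized_basic_inequality[OF this, of "D \<omega>"] * D0
    show "(a \<omega>)\<^sup>2 \<le> (b A)\<^sup>2
      + 2 * D \<omega> * sqrt (k \<omega> + real (rank A)) * (a \<omega> + b A) + lambda * (real (rank A) - k \<omega>)"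
      by (simp add: a_def b_def k_def)
  qed

  have high_prob: "1 - exp (- (m + real r) / 2) \<le> measure M {\<omega> \<in> space M. P \<omega>}"
    if "AE \<omega> in M. D \<omega> \<le> 2 * \<sigma> * s \<longrightarrow> P \<omega>" and [measurable]: "Measurable.pred M P" for P
  proof -
    have "1 - exp (- (m + real r) / 2) \<le> 1 - measure M {\<omega> \<in> space M. 2 * \<sigma> * s < D \<omega>}"
      using tail by simp
    also have "\<dots> = measure M (space M - {\<omega> \<in> space M. 2 * \<sigma> * s < D \<omega>})"
      by (rule prob_compl [symmetric]) measurable
    also have "\<dots> \<le> measure M {\<omega> \<in> space M. P \<omega>}"
      using that(1) by (intro finite_measure_mono_AE) (auto simp: not_less)
    finally show ?thesis .
  qed

  have good: "AE \<omega> in M. D \<omega> \<le> 2 * \<sigma> * s \<longrightarrow>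
      (\<forall>A. a \<omega> \<le> b A + 2 * sqrt (lambda * max (r0 / \<rho>\<^sup>2) (real (rank A))))"
    using basic
  proof (eventually_elim, intro impI allI)
    fix \<omega> and A :: "real^'m2^'m1"
    assume *: "\<forall>A. (a \<omega>)\<^sup>2 \<le> (b A)\<^sup>2
      + 2 * D \<omega> * sqrt (k \<omega> + real (rank A)) * (a \<omega> + b A) + lambda * (real (rank A) - k \<omega>)"
      and "D \<omega> \<le> 2 * \<sigma> * s"
    then have "D \<omega> \<le> sqrt lambda / (2 * \<rho>)" using \<rho> by (simp add: sqrt_lambda)
    moreover have "(a \<omega>)\<^sup>2 \<le> 2 * D \<omega> * sqrt (k \<omega> + r0) * a \<omega> + lambda * (r0 - k \<omega>)"
      using *[rule_format, of A0] by (simp add: b0 r0_def)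
    ultimately show "a \<omega> \<le> b A + 2 * sqrt (lambda * max (r0 / \<rho>\<^sup>2) (real (rank A)))"
      using * D0 lambda_pos \<rho> nonneg by (intro oracle_inequality[where k = "k \<omega>" and D = "D \<omega>"]) auto
  qed

  have squared: "AE \<omega> in M. \<forall>A. (2 * \<rho>\<^sup>2 - 1) * (a \<omega>)\<^sup>2 \<le> (2 * \<rho>\<^sup>2 + 1) * (b A)\<^sup>2 + 4 * \<rho>\<^sup>2 * lambda * real (rank A)
      + 8 * \<rho>^4 * (((D \<omega>)\<^sup>2 - 4 * \<sigma>\<^sup>2 * s\<^sup>2) * (k \<omega> + real (rank A)))"
    using basic
  proof (eventually_elim, intro allI)
    fix \<omega> and A :: "real^'m2^'m1"
    assume *: "\<forall>A. (a \<omega>)\<^sup>2 \<le> (b A)\<^sup>2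
      + 2 * D \<omega> * sqrt (k \<omega> + real (rank A)) * (a \<omega> + b A) + lambda * (real (rank A) - k \<omega>)"
    have "8 * \<rho>^4 * (D \<omega>)\<^sup>2 - 2 * \<rho>\<^sup>2 * lambda = 8 * \<rho>^4 * ((D \<omega>)\<^sup>2 - 4 * \<sigma>\<^sup>2 * s\<^sup>2)"
      by (simp add: lambda power4_eq_xxxx power2_eq_square algebra_simps)
    with squared_oracle_inequality[OF *[rule_format, of A], of \<rho>] nonneg
    show "(2 * \<rho>\<^sup>2 - 1) * (a \<omega>)\<^sup>2 \<le> (2 * \<rho>\<^sup>2 + 1) * (b A)\<^sup>2 + 4 * \<rho>\<^sup>2 * lambda * real (rank A)
      + 8 * \<rho>^4 * (((D \<omega>)\<^sup>2 - 4 * \<sigma>\<^sup>2 * s\<^sup>2) * (k \<omega> + real (rank A)))"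
      by (simp add: mult.assoc)
  qed

  have i: "1 - exp (- (m + real r) / 2) \<le> measure M {\<omega> \<in> space M.
      a \<omega> \<le> (INF A. b A + 2 * sqrt (lambda * max (r0 / \<rho>\<^sup>2) (real (rank A)))) \<and>
      a \<omega> \<le> 8 * \<rho> * \<sigma> * s * sqrt r0}"
  proof (rule high_prob)
    have A0: "b A0 + 2 * sqrt (lambda * max (r0 / \<rho>\<^sup>2) (real (rank A0))) = 8 * \<rho> * \<sigma> * s * sqrt r0"
    proof -
      have "max (r0 / \<rho>\<^sup>2) (real (rank A0)) = r0" using r0_div by (simp add: r0_def)
      then show ?thesis by (simp add: b0 real_sqrt_mult sqrt_lambda)
    qed
    show "AE \<omega> in M. D \<omega> \<le> 2 * \<sigma> * s \<longrightarrow>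
      a \<omega> \<le> (INF A. b A + 2 * sqrt (lambda * max (r0 / \<rho>\<^sup>2) (real (rank A)))) \<and>
      a \<omega> \<le> 8 * \<rho> * \<sigma> * s * sqrt r0"
      using good
    proof (eventually_elim, intro impI conjI)
      fix \<omega>
      assume *: "D \<omega> \<le> 2 * \<sigma> * s \<longrightarrow>
        (\<forall>A. a \<omega> \<le> b A + 2 * sqrt (lambda * max (r0 / \<rho>\<^sup>2) (real (rank A))))" "D \<omega> \<le> 2 * \<sigma> * s"
      then show "a \<omega> \<le> (INF A. b A + 2 * sqrt (lambda * max (r0 / \<rho>\<^sup>2) (real (rank A))))"
        by (intro cINF_greatest) auto
      from * show "a \<omega> \<le> 8 * \<rho> * \<sigma> * s * sqrt r0"
        using A0 by metis
    qed
  qed measurable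

  have ii: "1 - exp (- (m + real r) / 2) \<le> measure M {\<omega> \<in> space M.
      (a \<omega>)\<^sup>2 \<le> (INF A. (2 * \<rho>\<^sup>2 + 1) / (2 * \<rho>\<^sup>2 - 1) * (b A)\<^sup>2
        + 4 * \<rho>\<^sup>2 * lambda / (2 * \<rho>\<^sup>2 - 1) * real (rank A))}"
  proof (rule high_prob)
    show "AE \<omega> in M. D \<omega> \<le> 2 * \<sigma> * s \<longrightarrow>
      (a \<omega>)\<^sup>2 \<le> (INF A. (2 * \<rho>\<^sup>2 + 1) / (2 * \<rho>\<^sup>2 - 1) * (b A)\<^sup>2
        + 4 * \<rho>\<^sup>2 * lambda / (2 * \<rho>\<^sup>2 - 1) * real (rank A))"
      using squared
    proof (eventually_elim, intro impI cINF_greatest)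
      fix \<omega> and A :: "real^'m2^'m1"
      assume *: "\<forall>A. (2 * \<rho>\<^sup>2 - 1) * (a \<omega>)\<^sup>2 \<le> (2 * \<rho>\<^sup>2 + 1) * (b A)\<^sup>2 + 4 * \<rho>\<^sup>2 * lambda * real (rank A)
        + 8 * \<rho>^4 * (((D \<omega>)\<^sup>2 - 4 * \<sigma>\<^sup>2 * s\<^sup>2) * (k \<omega> + real (rank A)))" and "D \<omega> \<le> 2 * \<sigma> * s"
      then have "(D \<omega>)\<^sup>2 \<le> (2 * \<sigma> * s)\<^sup>2" using D0 by (intro power_mono) auto
      then have "((D \<omega>)\<^sup>2 - 4 * \<sigma>\<^sup>2 * s\<^sup>2) * (k \<omega> + real (rank A)) \<le> 0"
        using nonneg by (intro mult_nonpos_nonneg) (auto simp: power_mult_distrib)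
      then have "8 * \<rho>^4 * (((D \<omega>)\<^sup>2 - 4 * \<sigma>\<^sup>2 * s\<^sup>2) * (k \<omega> + real (rank A))) \<le> 0"
        by (rule mult_nonneg_nonpos[rotated]) simp
      with *[rule_format, of A] have "(2 * \<rho>\<^sup>2 - 1) * (a \<omega>)\<^sup>2 \<le> (2 * \<rho>\<^sup>2 + 1) * (b A)\<^sup>2 + 4 * \<rho>\<^sup>2 * lambda * real (rank A)"
        by linarith
      then show "(a \<omega>)\<^sup>2 \<le> (2 * \<rho>\<^sup>2 + 1) / (2 * \<rho>\<^sup>2 - 1) * (b A)\<^sup>2
        + 4 * \<rho>\<^sup>2 * lambda / (2 * \<rho>\<^sup>2 - 1) * real (rank A)"
        using \<rho>(3) by (simp add: add_divide_distrib [symmetric] pos_le_divide_eq mult.commute)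
    qed simp
  qed measurable

  \<comment> \<open>outside the good event the crude bound is linear in \<open>D\<close>, and there \<open>D\<close> is at most a
     multiple of the excess \<open>T\<close>, since \<open>T\<close> is at least \<open>D\<^sup>2 / 5\<close>\<close>
  have linear: "AE \<omega> in M. \<forall>A. a \<omega> \<le> b A + 2 * sqrt (lambda * max (r0 / \<rho>\<^sup>2) (real (rank A)))
      + 5 * sqrt (2 * m) / (\<sigma> * s) * T \<omega>"
    using good basic
  proof (eventually_elim, intro allI)
    fix \<omega> and A :: "real^'m2^'m1"
    let ?\<mu> = "max (r0 / \<rho>\<^sup>2) (real (rank A))"
    assume good: "D \<omega> \<le> 2 * \<sigma> * s \<longrightarrow> (\<forall>A. a \<omega> \<le> b A + 2 * sqrt (lambda * max (r0 / \<rho>\<^sup>2) (real (rank A))))"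
      and *: "\<forall>A. (a \<omega>)\<^sup>2 \<le> (b A)\<^sup>2
      + 2 * D \<omega> * sqrt (k \<omega> + real (rank A)) * (a \<omega> + b A) + lambda * (real (rank A) - k \<omega>)"
    show "a \<omega> \<le> b A + 2 * sqrt (lambda * ?\<mu>) + 5 * sqrt (2 * m) / (\<sigma> * s) * T \<omega>"
    proof (cases "D \<omega> \<le> 2 * \<sigma> * s")
      case True
      have "0 \<le> 5 * sqrt (2 * m) / (\<sigma> * s) * T \<omega>"
        using T0 s assms(2) m16 by (intro mult_nonneg_nonneg divide_nonneg_nonneg) auto
      moreover have "a \<omega> \<le> b A + 2 * sqrt (lambda * ?\<mu>)" using good True by blast
      ultimately show ?thesis by linarith
    next
      case False
      have "a \<omega> \<le> b A + 2 * sqrt (lambda * real (rank A)) + 2 * D \<omega> * sqrt (2 * m)"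
        using * D0 lambda_pos nonneg rank_le
        by (intro crude_oracle_inequality[where k = "k \<omega>"]) (auto simp: k_def)
      moreover have "sqrt (lambda * real (rank A)) \<le> sqrt (lambda * ?\<mu>)"
        using lambda_pos by (intro real_sqrt_le_mono mult_left_mono) auto
      moreover have "2 * D \<omega> * sqrt (2 * m) \<le> 5 * sqrt (2 * m) / (\<sigma> * s) * T \<omega>"
      proof -
        have pos: "0 < \<sigma> * s" using assms(2) s by simp
        have "D \<omega> * (2 * \<sigma> * s) \<le> D \<omega> * D \<omega>"
          using False D0 by (intro mult_left_mono) auto
        moreover have "(2 * \<sigma> * s) * (2 * \<sigma> * s) \<le> D \<omega> * D \<omega>"
          using False pos by (intro mult_mono) auto
        moreover have "(D \<omega>)\<^sup>2 - 16 / 5 * \<sigma>\<^sup>2 * s\<^sup>2 \<le> T \<omega>" by (simp add: T_def)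
        ultimately have "2 * D \<omega> * (\<sigma> * s) \<le> 5 * T \<omega>"
          by (simp add: power2_eq_square algebra_simps)
        then have "2 * D \<omega> \<le> 5 * T \<omega> / (\<sigma> * s)" using pos by (simp only: pos_le_divide_eq)
        then have "2 * D \<omega> * sqrt (2 * m) \<le> 5 * T \<omega> / (\<sigma> * s) * sqrt (2 * m)"
          using m16 by (intro mult_right_mono) auto
        then show ?thesis by (simp add: mult_ac)
      qed
      ultimately show ?thesis by linarith
    qed
  qed

  have int_a: "integrable M a"
  proof (rule Bochner_Integration.integrable_bound)
    show "integrable M (\<lambda>\<omega>. b A0 + 2 * sqrt (lambda * max (r0 / \<rho>\<^sup>2) (real (rank A0)))
      + 5 * sqrt (2 * m) / (\<sigma> * s) * T \<omega>)"
      by (intro Bochner_Integration.integrable_add integrable_mult_right int_T integrable_const)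
    show "AE \<omega> in M. norm (a \<omega>) \<le> norm (b A0 + 2 * sqrt (lambda * max (r0 / \<rho>\<^sup>2) (real (rank A0)))
      + 5 * sqrt (2 * m) / (\<sigma> * s) * T \<omega>)"
      using linear
    proof eventually_elim
      fix \<omega>
      assume "\<forall>A. a \<omega> \<le> b A + 2 * sqrt (lambda * max (r0 / \<rho>\<^sup>2) (real (rank A)))
        + 5 * sqrt (2 * m) / (\<sigma> * s) * T \<omega>"
      from this[rule_format, of A0] show "norm (a \<omega>) \<le> norm (b A0 + 2 * sqrt (lambda * max (r0 / \<rho>\<^sup>2) (real (rank A0)))
        + 5 * sqrt (2 * m) / (\<sigma> * s) * T \<omega>)"
        using nonneg(1)[of \<omega>] by simp
    qed
  qed measurable

  have iii: "(\<integral>\<omega>. a \<omega> \<partial>M) \<le> b A + 5 / 2 * sqrt (lambda * max (real (rank A)) (max (r0 / \<rho>\<^sup>2) (1 / (4 * \<rho>\<^sup>2))))" for A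
  proof -
    let ?\<mu> = "max (real (rank A)) (max (r0 / \<rho>\<^sup>2) (1 / (4 * \<rho>\<^sup>2)))"
    let ?c = "5 * sqrt (2 * m) / (\<sigma> * s)"
    have "(\<integral>\<omega>. a \<omega> \<partial>M) \<le> (\<integral>\<omega>. b A + 2 * sqrt (lambda * max (r0 / \<rho>\<^sup>2) (real (rank A))) + ?c * T \<omega> \<partial>M)"
      by (intro integral_mono_AE int_a Bochner_Integration.integrable_add integrable_mult_right int_T
          integrable_const) (use linear in \<open>auto elim: eventually_mono\<close>)
    also have "\<dots> = b A + 2 * sqrt (lambda * max (r0 / \<rho>\<^sup>2) (real (rank A))) + ?c * (\<integral>\<omega>. T \<omega> \<partial>M)"
      using int_T by (simp add: prob_space)
    also have "2 * sqrt (lambda * max (r0 / \<rho>\<^sup>2) (real (rank A))) \<le> 2 * sqrt (lambda * ?\<mu>)"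
      using lambda_pos by (intro mult_left_mono real_sqrt_le_mono) auto
    also have "?c * (\<integral>\<omega>. T \<omega> \<partial>M) \<le> 1 / 2 * sqrt (lambda * ?\<mu>)"
    proof -
      have "?c * (\<integral>\<omega>. T \<omega> \<partial>M) \<le> ?c * (\<sigma>\<^sup>2 / 2)"
        using exp_T assms(2) s m16 by (intro mult_left_mono divide_nonneg_nonneg) auto
      also have "\<dots> = 5 / 2 * sqrt 2 * \<sigma> * (sqrt m / s)"
        using assms(2) by (simp add: real_sqrt_mult power2_eq_square mult_ac)
      also have "\<dots> \<le> 5 / 2 * sqrt 2 * \<sigma> * 1"
        using s assms(2) by (intro mult_left_mono) auto
      also have "\<dots> \<le> 4 * \<sigma>"
      proof -
        have "sqrt 2 \<le> 8 / 5" by (rule real_le_lsqrt) (simp_all add: power2_eq_square)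
        then show ?thesis using assms(2) by simp
      qed
      \<comment> \<open>the term \<open>1 / (4 \<rho>\<^sup>2)\<close> in the maximum makes the desired bound at least \<open>\<sigma> s\<close>\<close>
      also have "\<dots> \<le> \<sigma> * s" using s assms(2) by simp
      also have "\<dots> = 1 / 2 * (sqrt lambda * (1 / (2 * \<rho>)))"
        using \<rho> by (simp add: sqrt_lambda)
      also have "1 / (2 * \<rho>) = sqrt (1 / (4 * \<rho>\<^sup>2))"
        using \<rho> by (simp add: real_sqrt_divide real_sqrt_mult)
      also have "sqrt lambda * \<dots> = sqrt (lambda * (1 / (4 * \<rho>\<^sup>2)))" by (rule real_sqrt_mult [symmetric])
      also have "1 / 2 * \<dots> \<le> 1 / 2 * sqrt (lambda * ?\<mu>)"
        using lambda_pos by (intro mult_left_mono real_sqrt_le_mono) auto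
      finally show ?thesis .
    qed
    finally show ?thesis by simp
  qed
  have iii': "(\<integral>\<omega>. a \<omega> \<partial>M) \<le> 10 * \<rho> * \<sigma> * s * sqrt (max r0 (1 / 4))"
  proof -
    have "1 / (4 * \<rho>\<^sup>2) \<le> 1 / 4" using \<rho> by (intro divide_left_mono) auto
    with r0_div have "max (real (rank A0)) (max (r0 / \<rho>\<^sup>2) (1 / (4 * \<rho>\<^sup>2))) \<le> max r0 (1 / 4)"
      unfolding r0_def by linarith
    then have "sqrt (lambda * max (real (rank A0)) (max (r0 / \<rho>\<^sup>2) (1 / (4 * \<rho>\<^sup>2))))
        \<le> sqrt (lambda * max r0 (1 / 4))"
      using lambda_pos by (intro real_sqrt_le_mono mult_left_mono) auto
    also have "\<dots> = 4 * \<rho> * \<sigma> * s * sqrt (max r0 (1 / 4))" by (simp only: real_sqrt_mult sqrt_lambda)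
    finally show ?thesis using iii[of A0] b0 by simp
  qed

  \<comment> \<open>the negative term is essential: for \<open>rank A \<ge> 1\<close> the bound on the mean leaves no room
     for the mean excess unless the typical case contributes a gain\<close>
  have squared_excess: "AE \<omega> in M. \<forall>A. (2 * \<rho>\<^sup>2 - 1) * (a \<omega>)\<^sup>2 \<le> (2 * \<rho>\<^sup>2 + 1) * (b A)\<^sup>2 + 4 * \<rho>\<^sup>2 * lambda * real (rank A)
      + 8 * \<rho>^4 * ((m + real (rank A)) * T \<omega> - 4 / 5 * \<sigma>\<^sup>2 * s\<^sup>2 * real (rank A))"
    using squared
  proof (eventually_elim, intro allI)
    fix \<omega> and A :: "real^'m2^'m1"
    assume *: "\<forall>A. (2 * \<rho>\<^sup>2 - 1) * (a \<omega>)\<^sup>2 \<le> (2 * \<rho>\<^sup>2 + 1) * (b A)\<^sup>2 + 4 * \<rho>\<^sup>2 * lambda * real (rank A)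
      + 8 * \<rho>^4 * (((D \<omega>)\<^sup>2 - 4 * \<sigma>\<^sup>2 * s\<^sup>2) * (k \<omega> + real (rank A)))"
    have "((D \<omega>)\<^sup>2 - 4 * \<sigma>\<^sup>2 * s\<^sup>2) * (k \<omega> + real (rank A))
        \<le> (m + real (rank A)) * T \<omega> - 4 / 5 * \<sigma>\<^sup>2 * s\<^sup>2 * real (rank A)"
      using noise_excess_times_rank[of "4 / 5 * \<sigma>\<^sup>2 * s\<^sup>2" "k \<omega>" m "real (rank A)" "(D \<omega>)\<^sup>2"] rank_le
      by (simp add: T_def k_def mult.assoc)
    then have "8 * \<rho>^4 * (((D \<omega>)\<^sup>2 - 4 * \<sigma>\<^sup>2 * s\<^sup>2) * (k \<omega> + real (rank A)))
        \<le> 8 * \<rho>^4 * ((m + real (rank A)) * T \<omega> - 4 / 5 * \<sigma>\<^sup>2 * s\<^sup>2 * real (rank A))"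
      by (rule mult_left_mono) simp
    with *[rule_format, of A] show "(2 * \<rho>\<^sup>2 - 1) * (a \<omega>)\<^sup>2 \<le> (2 * \<rho>\<^sup>2 + 1) * (b A)\<^sup>2 + 4 * \<rho>\<^sup>2 * lambda * real (rank A)
      + 8 * \<rho>^4 * ((m + real (rank A)) * T \<omega> - 4 / 5 * \<sigma>\<^sup>2 * s\<^sup>2 * real (rank A))"
      by linarith
  qed

  let ?R = "\<lambda>A \<omega>. (2 * \<rho>\<^sup>2 + 1) * (b A)\<^sup>2 + 4 * \<rho>\<^sup>2 * lambda * real (rank A)
      + 8 * \<rho>^4 * ((m + real (rank A)) * T \<omega> - 4 / 5 * \<sigma>\<^sup>2 * s\<^sup>2 * real (rank A))"
  have int_R: "integrable M (?R A)" for A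
    by (intro Bochner_Integration.integrable_add Bochner_Integration.integrable_diff
        integrable_mult_right int_T integrable_const)
  have int_a2: "integrable M (\<lambda>\<omega>. (2 * \<rho>\<^sup>2 - 1) * (a \<omega>)\<^sup>2)"
  proof (rule Bochner_Integration.integrable_bound[OF int_R[of A0]])
    show "AE \<omega> in M. norm ((2 * \<rho>\<^sup>2 - 1) * (a \<omega>)\<^sup>2) \<le> norm (?R A0 \<omega>)"
      using squared_excess
    proof eventually_elim
      fix \<omega>
      assume "\<forall>A. (2 * \<rho>\<^sup>2 - 1) * (a \<omega>)\<^sup>2 \<le> ?R A \<omega>"
      then have "(2 * \<rho>\<^sup>2 - 1) * (a \<omega>)\<^sup>2 \<le> ?R A0 \<omega>" by blast
      moreover have "0 \<le> (2 * \<rho>\<^sup>2 - 1) * (a \<omega>)\<^sup>2" using \<rho>(3) by simp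
      ultimately show "norm ((2 * \<rho>\<^sup>2 - 1) * (a \<omega>)\<^sup>2) \<le> norm (?R A0 \<omega>)" by simp
    qed
  qed measurable
  have iv: "(\<integral>\<omega>. (a \<omega>)\<^sup>2 \<partial>M) \<le> (2 * \<rho>\<^sup>2 + 1) / (2 * \<rho>\<^sup>2 - 1) * (b A)\<^sup>2
      + 4 * \<rho>\<^sup>2 * lambda / (2 * \<rho>\<^sup>2 - 1) * max (real (rank A)) (1 / 2)" for A
  proof -
    let ?k = "real (rank A)"
    have excess: "(m + ?k) * (\<integral>\<omega>. T \<omega> \<partial>M) - 4 / 5 * \<sigma>\<^sup>2 * s\<^sup>2 * ?k \<le> 8 * \<sigma>\<^sup>2 * s\<^sup>2 * (max ?k (1 / 2) - ?k)"
    proof -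
      have "(m + ?k) * (\<integral>\<omega>. T \<omega> \<partial>M) \<le> (m + ?k) * (\<sigma>\<^sup>2 / 2)"
        using exp_T m16 by (intro mult_left_mono) auto
      moreover have "(m + ?k) / 2 - 4 / 5 * s\<^sup>2 * ?k \<le> 8 * s\<^sup>2 * (max ?k (1 / 2) - ?k)"
      proof (cases "rank A = 0")
        case True
        then show ?thesis using s m16 by simp
      next
        case False
        then have k1: "1 \<le> ?k" by simp
        then have "m * 1 \<le> m * ?k" "16 * ?k \<le> m * ?k" "m * ?k \<le> s\<^sup>2 * ?k"
          using m16 s by (auto intro!: mult_left_mono mult_right_mono)
        then have "(m + ?k) / 2 - 4 / 5 * (s\<^sup>2 * ?k) \<le> 0"
          unfolding add_divide_distrib using m16 by linarith
        moreover have "max ?k (1 / 2) = ?k" using k1 by linarith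
        ultimately show ?thesis by (simp only: mult.assoc) simp
      qed
      then have "\<sigma>\<^sup>2 * ((m + ?k) / 2 - 4 / 5 * s\<^sup>2 * ?k) \<le> \<sigma>\<^sup>2 * (8 * s\<^sup>2 * (max ?k (1 / 2) - ?k))"
        by (rule mult_left_mono) simp
      ultimately show ?thesis by (simp add: field_simps)
    qed
    have "(2 * \<rho>\<^sup>2 - 1) * (\<integral>\<omega>. (a \<omega>)\<^sup>2 \<partial>M) = (\<integral>\<omega>. (2 * \<rho>\<^sup>2 - 1) * (a \<omega>)\<^sup>2 \<partial>M)" by simp
    also have "\<dots> \<le> (\<integral>\<omega>. ?R A \<omega> \<partial>M)"
      by (intro integral_mono_AE int_a2 int_R) (use squared_excess in \<open>auto elim: eventually_mono\<close>)
    also have "\<dots> = (2 * \<rho>\<^sup>2 + 1) * (b A)\<^sup>2 + 4 * \<rho>\<^sup>2 * lambda * ?k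
      + 8 * \<rho>^4 * ((m + ?k) * (\<integral>\<omega>. T \<omega> \<partial>M) - 4 / 5 * \<sigma>\<^sup>2 * s\<^sup>2 * ?k)"
      using int_T by (simp add: prob_space)
    also have "\<dots> \<le> (2 * \<rho>\<^sup>2 + 1) * (b A)\<^sup>2 + 4 * \<rho>\<^sup>2 * lambda * ?k
      + 8 * \<rho>^4 * (8 * \<sigma>\<^sup>2 * s\<^sup>2 * (max ?k (1 / 2) - ?k))"
      by (intro add_left_mono mult_left_mono excess) simp
    also have "8 * \<rho>^4 * (8 * \<sigma>\<^sup>2 * s\<^sup>2 * (max ?k (1 / 2) - ?k)) = 4 * \<rho>\<^sup>2 * lambda * (max ?k (1 / 2) - ?k)"
      by (simp add: lambda power4_eq_xxxx power2_eq_square)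
    finally have "(2 * \<rho>\<^sup>2 - 1) * (\<integral>\<omega>. (a \<omega>)\<^sup>2 \<partial>M)
        \<le> (2 * \<rho>\<^sup>2 + 1) * (b A)\<^sup>2 + 4 * \<rho>\<^sup>2 * lambda * max ?k (1 / 2)"
      by (simp add: algebra_simps)
    then show ?thesis
      using \<rho>(3) by (simp add: add_divide_distrib [symmetric] pos_le_divide_eq mult.commute)
  qed
  have iv': "(\<integral>\<omega>. (a \<omega>)\<^sup>2 \<partial>M) \<le> 64 * \<rho>\<^sup>2 * \<sigma>\<^sup>2 * s\<^sup>2 * max r0 (1 / 2)"
  proof -
    have "4 * \<rho>\<^sup>2 * lambda / (2 * \<rho>\<^sup>2 - 1) \<le> 4 * lambda"
      using \<rho> lambda_pos by (simp add: pos_divide_le_eq algebra_simps)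
    then have "4 * \<rho>\<^sup>2 * lambda / (2 * \<rho>\<^sup>2 - 1) * max r0 (1 / 2) \<le> 4 * lambda * max r0 (1 / 2)"
      by (rule mult_right_mono) simp
    then show ?thesis using iv[of A0] b0 by (simp add: lambda r0_def)
  qed
  have "integrable M (\<lambda>\<omega>. (a \<omega>)\<^sup>2)" using int_a2 \<rho>(3) by simp
  moreover have "(\<integral>\<omega>. a \<omega> \<partial>M) \<le> (INF A. b A + 5 / 2 * sqrt (lambda * max (real (rank A)) (max (r0 / \<rho>\<^sup>2) (1 / (4 * \<rho>\<^sup>2)))))"
    by (rule cINF_greatest[OF _ iii]) simp
  moreover have "(\<integral>\<omega>. (a \<omega>)\<^sup>2 \<partial>M) \<le> (INF A. (2 * \<rho>\<^sup>2 + 1) / (2 * \<rho>\<^sup>2 - 1) * (b A)\<^sup>2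
      + 4 * \<rho>\<^sup>2 * lambda / (2 * \<rho>\<^sup>2 - 1) * max (real (rank A)) (1 / 2))"
    by (rule cINF_greatest[OF _ iv]) simp
  ultimately show ?thesis
    using i ii int_a iii' iv'
    unfolding a_def b_def r0_def s_def m_def by blast
qed

end
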